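(* Let $G$ be a finite connected non-bipartite undirected graph. Then $G$ admits a 2-edge-colouring $c:E(G)\to\{1,2\}$ under which it is properly connected if and only if there exists an $\mathscr S$-free component $\mathcal K$ of $G$ such that $G\setminus\mathcal K$ is empty or can be made 2-edge-connected by adding at most one edge.
   Context: A walk is a sequence of vertices $v_0,\dots,v_l$ with consecutive vertices adjacent (vertices and edges may repeat); its length is $l$; it is closed if $v_0=v_l$. A walk in an edge-coloured graph is properly coloured if no two consecutive edges of it have the same colour. The coloured graph is properly connected if every two vertices are joined by a properly coloured walk. An edge is stubborn if it belongs to every closed walk of odd length in $G$; $\mathscr S$ is the set of stubborn edges. An $\mathscr S$-free component is (the vertex set of) a connected component of $G\setminus\mathscr S$ (the graph with all stubborn edges deleted). $G\setminus\mathcal K$ denotes the subgraph induced on $V(G)\setminus\mathcal K$. A graph is 2-edge-connected if it is connected and bridgeless (a single vertex counts); a graph "can be made 2-edge-connected by adding at most one edge" if it is 2-edge-connected or there is an edge $e$ (possibly parallel to an existing edge) whose addition makes it 2-edge-connected. *)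

theory Defs
  imports Main "HOL-Library.Multiset"
begin

text \<open>Undirected graphs are given by a vertex set and a set of edges, an edge being the
  two-element set of its ends.\<close>

definition simple_graph :: "'a set \<Rightarrow> 'a set set \<Rightarrow> bool" where
  "simple_graph V E \<longleftrightarrow> (\<forall>e\<in>E. e \<subseteq> V \<and> card e = 2)"

fun walk_edges :: "'a list \<Rightarrow> 'a set list" where
  "walk_edges (x # y # p) = {x, y} # walk_edges (y # p)"
| "walk_edges _ = []"

definition walk :: "'a set \<Rightarrow> 'a set set \<Rightarrow> 'a list \<Rightarrow> bool" where
  "walk V E p \<longleftrightarrow> p \<noteq> [] \<and> set p \<subseteq> V \<and> set (walk_edges p) \<subseteq> E"

definition walk_length :: "'a list \<Rightarrow> nat" where
  "walk_length p = length (walk_edges p)"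

definition closed_walk :: "'a set \<Rightarrow> 'a set set \<Rightarrow> 'a list \<Rightarrow> bool" where
  "closed_walk V E p \<longleftrightarrow> walk V E p \<and> hd p = last p"

definition joined :: "'a set \<Rightarrow> 'a set set \<Rightarrow> 'a \<Rightarrow> 'a \<Rightarrow> bool" where
  "joined V E u v \<longleftrightarrow> (\<exists>p. walk V E p \<and> hd p = u \<and> last p = v)"

definition connected_graph :: "'a set \<Rightarrow> 'a set set \<Rightarrow> bool" where
  "connected_graph V E \<longleftrightarrow> V \<noteq> {} \<and> (\<forall>u\<in>V. \<forall>v\<in>V. joined V E u v)"

definition components :: "'a set \<Rightarrow> 'a set set \<Rightarrow> 'a set set" where
  "components V E = (\<lambda>u. {v \<in> V. joined V E u v}) ` V"

definition bipartite :: "'a set \<Rightarrow> 'a set set \<Rightarrow> bool" where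
  "bipartite V E \<longleftrightarrow>
    (\<exists>X Y. X \<union> Y = V \<and> X \<inter> Y = {} \<and> (\<forall>e\<in>E. \<exists>x\<in>X. \<exists>y\<in>Y. e = {x, y}))"

definition properly_coloured :: "('a set \<Rightarrow> nat) \<Rightarrow> 'a list \<Rightarrow> bool" where
  "properly_coloured c p \<longleftrightarrow> successively (\<lambda>e f. c e \<noteq> c f) (walk_edges p)"

definition properly_connected :: "'a set \<Rightarrow> 'a set set \<Rightarrow> ('a set \<Rightarrow> nat) \<Rightarrow> bool" where
  "properly_connected V E c \<longleftrightarrow>
    (\<forall>u\<in>V. \<forall>v\<in>V. \<exists>p. walk V E p \<and> hd p = u \<and> last p = v \<and> properly_coloured c p)"

definition stubborn_edges :: "'a set \<Rightarrow> 'a set set \<Rightarrow> 'a set set" where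
  "stubborn_edges V E =
    {e \<in> E. \<forall>p. closed_walk V E p \<and> odd (walk_length p) \<longrightarrow> e \<in> set (walk_edges p)}"

definition stubborn_free_components :: "'a set \<Rightarrow> 'a set set \<Rightarrow> 'a set set" where
  "stubborn_free_components V E = components V (E - stubborn_edges V E)"

definition induced_edges :: "'a set set \<Rightarrow> 'a set \<Rightarrow> 'a set set" where
  "induced_edges E W = {e \<in> E. e \<subseteq> W}"

text \<open>Adding an edge may create parallel edges, so 2-edge-connectedness is defined for
  multigraphs, with a multiset of edges. An edge is a bridge if deleting one copy of it
  separates its ends.\<close>

definition bridge :: "'a set \<Rightarrow> 'a set multiset \<Rightarrow> 'a set \<Rightarrow> bool" where
  "bridge V M e \<longleftrightarrow> e \<in># M \<and>
    (\<exists>x y. e = {x, y} \<and> \<not> joined V (set_mset (M - {#e#})) x y)"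

definition two_edge_connected :: "'a set \<Rightarrow> 'a set multiset \<Rightarrow> bool" where
  "two_edge_connected V M \<longleftrightarrow> connected_graph V (set_mset M) \<and> (\<forall>e. \<not> bridge V M e)"

definition two_edge_connectable :: "'a set \<Rightarrow> 'a set set \<Rightarrow> bool" where
  "two_edge_connectable V E \<longleftrightarrow>
    two_edge_connected V (mset_set E) \<or>
    (\<exists>e. e \<subseteq> V \<and> card e = 2 \<and> two_edge_connected V (add_mset e (mset_set E)))"

end

theory Submission
  imports Defs
begin

text \<open>A state (u, s) stands for being at u with the next edge to have colour s. A colouring thus
  orients the bipartite double cover of G skew-symmetrically, and properly coloured walks become
  directed walks. A maximal partial colouring in which every arc lies on a directed cycle colours
  every edge uv for which G - uv has a u-v walk of odd length; the remaining edges are bridges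
  or stubborn.

  Each stubborn edge e comes with a vertex 2-colouring that is proper except at e, and the sum of two
  of these is a cut consisting of exactly two stubborn edges. Given a properly connecting colouring,
  one side of each such cut cannot be crossed by properly coloured walks; a smallest such side is
  a stubborn-free component K, and the bipartite graph G - K is then unilaterally oriented.

  Conversely, the bridges inside K are directed towards the ends of two stubborn edges leaving K,
  and the bridges of G - K, which lie on a single path, are directed along that path; the two
  stubborn edges complete this to an odd directed tour through K.\<close>

section \<open>Skew-symmetric orientations\<close>

text \<open>Colouring one edge orients both of its lifts at once, so Robbins' theorem on strongly
  connected orientations does not apply to the double cover directly; skew-symmetry is what makes
  paths reroutable. Once every arc lies on a directed cycle, a coloured edge can be passed in both
  directions from either state, up to reachability, so the coloured part behaves like an undirected
  graph. Stubborn edges are the obstruction. For a stubborn edge e with 2-colouring \<phi>, the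
  states (w, \<phi> w) and (w, \<not> \<phi> w) form two sheets exchanged by \<open>flip\<close>.
  Every other edge stays within its sheet, while both lifts of e lead from one sheet to the other in
  the same direction, so e lies on no directed cycle. This one-way passage serves both halves of the
  proof: it turns one side of a two-edge cut into a trap, and it supplies the change of state in an
  odd tour. Such a tour at a root connects any two vertices that reach the root, because the second
  way can be walked backwards as its skew image.\<close>

definition adj :: "'a set set \<Rightarrow> 'a rel" where
  "adj E = {(u, v). {u, v} \<in> E}"

definition flip :: "'a \<times> bool \<Rightarrow> 'a \<times> bool" where
  "flip p = (fst p, \<not> snd p)"

definition skew :: "('a \<times> bool) rel \<Rightarrow> bool" where
  "skew R \<longleftrightarrow> (\<forall>p q. (p, q) \<in> R \<longrightarrow> (flip q, flip p) \<in> R)"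

definition arcs :: "'a set set \<Rightarrow> ('a set \<Rightarrow> bool) \<Rightarrow> ('a \<times> bool) rel" where
  "arcs E c = {((u, s), (v, \<not> s)) | u v s. {u, v} \<in> E \<and> c {u, v} = s}"

definition all_arcs :: "'a set set \<Rightarrow> ('a \<times> bool) rel" where
  "all_arcs E = {((u, s), (v, \<not> s)) | u v s. {u, v} \<in> E}"

text \<open>Equivalently, every weakly connected part of \<open>R\<close> is strongly connected: the
  property that Robbins' theorem yields for bridgeless graphs.\<close>

definition cyclic :: "('a \<times> bool) rel \<Rightarrow> bool" where
  "cyclic R \<longleftrightarrow> (\<forall>p q. (p, q) \<in> R \<longrightarrow> (q, p) \<in> R\<^sup>*)"

lemma flip_simps [simp]: "flip (u, s) = (u, \<not> s)" "flip (flip p) = p" "fst (flip p) = fst p"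
  by (simp_all add: flip_def)

lemma adj_iff: "(u, v) \<in> adj E \<longleftrightarrow> {u, v} \<in> E"
  by (simp add: adj_def)

lemma sym_adj: "sym (adj E)"
  by (auto simp: sym_def adj_def insert_commute)

lemma adj_rtrancl_sym: "(u, v) \<in> (adj E)\<^sup>* \<Longrightarrow> (v, u) \<in> (adj E)\<^sup>*"
  by (meson sym_adj sym_rtrancl symD)

lemma adj_mono: "E \<subseteq> E' \<Longrightarrow> adj E \<subseteq> adj E'"
  by (auto simp: adj_def)

lemma arcs_iff: "((u, s), (v, t)) \<in> arcs E c \<longleftrightarrow> {u, v} \<in> E \<and> c {u, v} = s \<and> t = (\<not> s)"
  by (auto simp: arcs_def)

lemma all_arcs_iff: "((u, s), (v, t)) \<in> all_arcs E \<longleftrightarrow> {u, v} \<in> E \<and> t = (\<not> s)"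
  by (auto simp: all_arcs_def)

lemma arcs_mono: "E \<subseteq> E' \<Longrightarrow> (\<And>e. e \<in> E \<Longrightarrow> c e = c' e) \<Longrightarrow> arcs E c \<subseteq> arcs E' c'"
  by (fastforce simp: arcs_def)

lemma skew_arcs: "skew (arcs E c)"
  by (auto simp: skew_def arcs_def insert_commute)

lemma skew_all_arcs: "skew (all_arcs E)"
  by (auto simp: skew_def all_arcs_def insert_commute)

lemma skew_Un: "skew R \<Longrightarrow> skew R' \<Longrightarrow> skew (R \<union> R')"
  by (auto simp: skew_def)

lemma skew_rtrancl:
  assumes "skew R" and "(p, q) \<in> R\<^sup>*"
  shows "(flip q, flip p) \<in> R\<^sup>*"
  using assms(2)
proof (induction rule: rtrancl_induct)
  case (step y z)
  then have "(flip z, flip y) \<in> R" using assms(1) unfolding skew_def by blast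
  with step show ?case by (meson converse_rtrancl_into_rtrancl)
qed simp

lemma sym_all_arcs_rtrancl: "(p, q) \<in> (all_arcs E)\<^sup>* \<Longrightarrow> (q, p) \<in> (all_arcs E)\<^sup>*"
proof -
  have "sym (all_arcs E)" by (auto simp: sym_def all_arcs_def insert_commute)
  then show "(p, q) \<in> (all_arcs E)\<^sup>* \<Longrightarrow> (q, p) \<in> (all_arcs E)\<^sup>*"
    by (meson sym_rtrancl symD)
qed

lemma rtrancl_insert_iff:
  "(x, y) \<in> (insert (a, b) R)\<^sup>* \<longleftrightarrow> (x, y) \<in> R\<^sup>* \<or> (x, a) \<in> R\<^sup>* \<and> (b, y) \<in> R\<^sup>*"
  by (auto simp: rtrancl_insert)

lemma all_arcs_Un: "all_arcs (E \<union> E') = all_arcs E \<union> all_arcs E'"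
  by (auto simp: all_arcs_def)

lemma arcs_Un: "arcs (E \<union> E') c = arcs E c \<union> arcs E' c"
  by (auto simp: arcs_def)

lemma arcs_cong: "(\<And>e. e \<in> E \<Longrightarrow> c e = c' e) \<Longrightarrow> arcs E c = arcs E c'"
  by (auto simp: arcs_def)

lemma arcs_single:
  "arcs {{u, v}} c = {((u, c {u, v}), (v, \<not> c {u, v})), ((v, c {u, v}), (u, \<not> c {u, v}))}"
  by (auto simp: arcs_def doubleton_eq_iff insert_commute)

lemma all_arcs_single:
  "all_arcs {{u, v}} = arcs {{u, v}} (\<lambda>_. s) \<union> arcs {{u, v}} (\<lambda>_. \<not> s)"
  by (auto simp: arcs_def all_arcs_def)

text \<open>If a path uses both lifts of an edge in conflicting directions, the skew image of the
  segment between them is a shortcut avoiding the edge.\<close>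

lemma colour_edge_on_path_step:
  fixes u v :: 'a
  defines "f s \<equiv> arcs {{u, v}} (\<lambda>_. s)"
  assumes "skew R" and q: "(q, y) \<in> (R \<union> f s)\<^sup>*" and yz: "(y, z) \<in> f (\<not> s)"
  shows "\<exists>t. (q, z) \<in> (R \<union> f t)\<^sup>*"
proof -
  have main: "\<exists>t. (q, b) \<in> (R \<union> f t)\<^sup>*"
    if y: "y = a" and z: "z = b" and f1: "f s = {(b, a), (flip a, flip b)}"
      and f2: "f (\<not> s) = {(a, b), (flip b, flip a)}" for a b
  proof -
    have e1: "R \<union> f s = insert (b, a) (insert (flip a, flip b) R)" using f1 by auto
    have e2: "R \<union> f (\<not> s) = insert (a, b) (insert (flip b, flip a) R)" using f2 by auto
    have sk: "(x, w) \<in> R\<^sup>* \<Longrightarrow> (flip w, flip x) \<in> R\<^sup>*" for x w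
      using skew_rtrancl[OF assms(2)] .
    have 1: "(q, a) \<in> R\<^sup>* \<Longrightarrow> (q, b) \<in> (R \<union> f (\<not> s))\<^sup>*"
      unfolding e2 rtrancl_insert_iff by auto
    have "(q, a) \<in> R\<^sup>* \<or> (q, b) \<in> (R \<union> f s)\<^sup>*"
      using q[unfolded y e1 rtrancl_insert_iff] sk[of "flip b" a]
      unfolding e1 rtrancl_insert_iff by (auto dest: rtrancl_trans)
    then show ?thesis using 1 by blast
  qed
  show ?thesis
  proof (cases s)
    case True
    have "y = (u, False) \<and> z = (v, True) \<or> y = (v, False) \<and> z = (u, True)"
      using yz True by (auto simp: f_def arcs_single)
    then show ?thesis
      using main[of "(u, False)" "(v, True)"] main[of "(v, False)" "(u, True)"] True
      by (auto simp: f_def arcs_single)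
  next
    case False
    have "y = (u, True) \<and> z = (v, False) \<or> y = (v, True) \<and> z = (u, False)"
      using yz False by (auto simp: f_def arcs_single)
    then show ?thesis
      using main[of "(u, True)" "(v, False)"] main[of "(v, True)" "(u, False)"] False
      by (auto simp: f_def arcs_single)
  qed
qed

lemma colour_edge_on_path:
  assumes "skew R" and "(q, p) \<in> (R \<union> all_arcs {{u, v}})\<^sup>*"
  shows "\<exists>s. (q, p) \<in> (R \<union> arcs {{u, v}} (\<lambda>_. s))\<^sup>*"
  using assms(2)
proof (induction rule: rtrancl_induct)
  case (step y z)
  then obtain s where s: "(q, y) \<in> (R \<union> arcs {{u, v}} (\<lambda>_. s))\<^sup>*" by blast
  from step(2) consider "(y, z) \<in> R \<union> arcs {{u, v}} (\<lambda>_. s)"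
    | "(y, z) \<in> arcs {{u, v}} (\<lambda>_. \<not> s)"
    unfolding all_arcs_single[of u v s] by blast
  then show ?case
  proof cases
    case 1
    with s show ?thesis by (meson rtrancl.rtrancl_into_rtrancl)
  next
    case 2
    show ?thesis by (rule colour_edge_on_path_step[OF assms(1) s 2])
  qed
qed auto

text \<open>Edges are coloured one at a time. Those still waiting keep both lifts inside the
  background relation, which therefore stays skew, and some path from \<open>q\<close> to
  \<open>p\<close> survives each choice.\<close>

lemma colour_path:
  assumes "finite E" "\<forall>e\<in>E. card e = 2" "skew R" and "(q, p) \<in> (R \<union> all_arcs E)\<^sup>*"
  shows "\<exists>c. (q, p) \<in> (R \<union> arcs E c)\<^sup>*"
  using assms
proof (induction E arbitrary: R rule: finite_induct)
  case empty
  then show ?case by (simp add: all_arcs_def arcs_def)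
next
  case (insert f E)
  obtain u v where f: "f = {u, v}" using insert.prems(1) by (auto simp: card_2_iff)
  have "all_arcs (insert f E) = all_arcs E \<union> all_arcs {{u, v}}"
    using all_arcs_Un[of "{f}" E] f by auto
  then have "(q, p) \<in> ((R \<union> all_arcs E) \<union> all_arcs {{u, v}})\<^sup>*"
    using insert.prems by (simp add: Un_assoc)
  from colour_edge_on_path[OF _ this] obtain s
    where "(q, p) \<in> ((R \<union> all_arcs E) \<union> arcs {{u, v}} (\<lambda>_. s))\<^sup>*"
    using insert.prems skew_Un skew_all_arcs by blast
  then have "(q, p) \<in> ((R \<union> arcs {{u, v}} (\<lambda>_. s)) \<union> all_arcs E)\<^sup>*"
    by (simp add: Un_ac)
  from insert.IH[OF _ _ this] obtain c
    where c: "(q, p) \<in> ((R \<union> arcs {{u, v}} (\<lambda>_. s)) \<union> arcs E c)\<^sup>*"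
    using insert.prems skew_Un skew_arcs by blast
  have "arcs (insert f E) (c(f := s)) = arcs {f} (c(f := s)) \<union> arcs E (c(f := s))"
    using arcs_Un[of "{f}" E] by simp
  also have "arcs {f} (c(f := s)) = arcs {{u, v}} (\<lambda>_. s)"
    unfolding f by (rule arcs_cong) auto
  also have "arcs E (c(f := s)) = arcs E c"
    using insert.hyps by (intro arcs_cong) auto
  finally show ?case using c by (intro exI[of _ "c(f := s)"]) (simp add: Un_assoc)
qed

text \<open>Colour \<open>s\<close> makes the new edge an arc from (u, s) to (v, \<not> s), and the
  assumed path closes it into a cycle once the uncoloured edges on that path have received colours.
  Among the sets of edges that can be coloured for this purpose a smallest is taken: each of its
  edges is then indispensable for getting from \<open>q\<close> to \<open>p\<close>, which forces it
  onto a cycle too.\<close>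

lemma extend_cyclic_colouring:
  assumes fin: "finite E" and two: "\<forall>e\<in>E. card e = 2" and "F \<subseteq> E" and cyc: "cyclic (arcs F c)"
    and e: "{u, v} \<in> E - F"
    and path: "((v, \<not> s), (u, s)) \<in> (arcs F c \<union> all_arcs (E - F - {{u, v}}))\<^sup>*"
  shows "\<exists>F' c'. F \<subset> F' \<and> F' \<subseteq> E \<and> cyclic (arcs F' c')"
proof -
  define e where "e = {u, v}"
  define p where "p = (u, s)"
  define q where "q = (v, \<not> s)"
  define Q where "Q F1 \<longleftrightarrow> F1 \<subseteq> E - F - {e} \<and> (\<exists>c1. (q, p) \<in> (arcs F c \<union> arcs F1 c1)\<^sup>*)" for F1
  have "Q (E - F - {e})"
    unfolding Q_def using colour_path[OF _ _ skew_arcs path] fin two by (auto simp: e_def p_def q_def)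
  then obtain F1 where F1: "Q F1" and min: "\<And>G. Q G \<Longrightarrow> card F1 \<le> card G"
    using ex_has_least_nat[of Q _ card] by blast
  obtain c1 where c1: "(q, p) \<in> (arcs F c \<union> arcs F1 c1)\<^sup>*" and F1E: "F1 \<subseteq> E - F - {e}"
    using F1 by (auto simp: Q_def)
  have finF1: "finite F1" using F1E fin finite_subset by blast
  define c' where "c' g = (if g \<in> F then c g else if g = e then s else c1 g)" for g
  define F' where "F' = F \<union> F1 \<union> {e}"
  define D where "D = arcs F' c'"
  have cF: "arcs F c' = arcs F c" by (rule arcs_cong) (simp add: c'_def)
  have c1': "arcs G c' = arcs G c1" if "G \<subseteq> F1" for G
    using F1E that by (intro arcs_cong) (auto simp: c'_def)
  have ce: "arcs {e} c' = {(p, q), (flip q, flip p)}"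
    using assms(5) by (auto simp: e_def arcs_single c'_def p_def q_def)
  have D: "D = arcs F c \<union> arcs F1 c1 \<union> {(p, q), (flip q, flip p)}"
    unfolding D_def F'_def arcs_Un ce cF c1'[OF subset_refl] ..
  have sk: "skew D" unfolding D_def by (rule skew_arcs)
  have qp: "(q, p) \<in> D\<^sup>*" using c1 unfolding D by (meson in_mono rtrancl_mono sup_ge1)
  have pq: "(p, q) \<in> D" by (simp add: D)
  have "cyclic D"
    unfolding cyclic_def
  proof (intro allI impI)
    fix y z assume "(y, z) \<in> D"
    then consider "(y, z) \<in> arcs F c" | "(y, z) \<in> arcs F1 c1" | "y = p" "z = q"
      | "y = flip q" "z = flip p"
      unfolding D by blast
    then show "(z, y) \<in> D\<^sup>*"
    proof cases
      case 1
      then have "(z, y) \<in> (arcs F c)\<^sup>*" using cyc unfolding cyclic_def by blast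
      then show ?thesis unfolding D by (meson in_mono rtrancl_mono sup_ge1 le_supI1)
    next
      case 2
      then obtain a b where ab: "y = (a, c1 {a, b})" "z = (b, \<not> c1 {a, b})" "{a, b} \<in> F1"
        by (auto simp: arcs_def)
      define R where "R = arcs F c \<union> arcs (F1 - {{a, b}}) c1"
      have "\<not> Q (F1 - {{a, b}})"
        using min[of "F1 - {{a, b}}"] ab(3) finF1 by (metis card_Diff1_less not_less)
      then have no: "(q, p) \<notin> R\<^sup>*" using F1E unfolding Q_def R_def by blast
      have "F1 = (F1 - {{a, b}}) \<union> {{a, b}}" using ab(3) by blast
      then have "arcs F1 c1 = arcs (F1 - {{a, b}}) c1 \<union> arcs {{a, b}} c1" by (metis arcs_Un)
      moreover have "arcs {{a, b}} c1 = {(y, z), (flip z, flip y)}"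
        by (auto simp: arcs_single ab)
      ultimately have eq: "arcs F c \<union> arcs F1 c1 = insert (y, z) (insert (flip z, flip y) R)"
        unfolding R_def by blast
      have RD: "R\<^sup>* \<subseteq> D\<^sup>*" by (rule rtrancl_mono) (use eq D in blast)
      have yzD: "(y, z) \<in> D" "(flip z, flip y) \<in> D" using eq D by blast+
      \<comment> \<open>Without the edge {a, b} the state \<open>p\<close> is out of reach, so the
        path uses one of its two lifts. The first lift closes up through \<open>p\<close> and
        \<open>q\<close>; for the second the same argument yields the skew image of the wanted
        return path.\<close>
      have "(q, y) \<in> R\<^sup>* \<and> (z, p) \<in> D\<^sup>* \<or> (q, flip z) \<in> R\<^sup>* \<and> (flip y, p) \<in> D\<^sup>*"
        using c1 no RD yzD unfolding eq rtrancl_insert_iff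
        by (smt (verit, best) in_mono converse_rtrancl_into_rtrancl rtrancl_trans)
      then consider "(q, y) \<in> D\<^sup>*" "(z, p) \<in> D\<^sup>*" | "(q, flip z) \<in> D\<^sup>*" "(flip y, p) \<in> D\<^sup>*"
        using RD by blast
      then show ?thesis
      proof cases
        case 1
        then show ?thesis using pq by (meson rtrancl.rtrancl_into_rtrancl rtrancl_trans)
      next
        case 2
        then have "(flip y, flip z) \<in> D\<^sup>*" using pq by (meson rtrancl.rtrancl_into_rtrancl rtrancl_trans)
        from skew_rtrancl[OF sk this] show ?thesis by simp
      qed
    next
      case 3
      then show ?thesis using qp by simp
    next
      case 4
      then show ?thesis using skew_rtrancl[OF sk qp] by simp
    qed
  qed
  moreover have "F \<subset> F'" using assms(5) by (auto simp: F'_def e_def)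
  moreover have "F' \<subseteq> E" using assms(3,5) F1E by (auto simp: F'_def e_def)
  ultimately show ?thesis unfolding D_def by blast
qed

lemma all_arcs_subset_cyclic:
  assumes "cyclic (arcs F c)"
  shows "all_arcs F \<subseteq> (arcs F c)\<^sup>*"
proof (clarsimp simp: all_arcs_def)
  fix u v s assume uv: "{u, v} \<in> F"
  show "((u, s), (v, \<not> s)) \<in> (arcs F c)\<^sup>*"
  proof (cases "c {u, v} = s")
    case True
    then show ?thesis using uv by (intro r_into_rtrancl) (simp add: arcs_iff)
  next
    case False
    then have "((v, \<not> s), (u, s)) \<in> arcs F c" using uv by (simp add: arcs_iff insert_commute)
    then show ?thesis using assms by (auto simp: cyclic_def)
  qed
qed

theorem skew_orientation:
  assumes fin: "finite E" and two: "\<forall>e\<in>E. card e = 2"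
  obtains F c where "F \<subseteq> E" "cyclic (arcs F c)"
    "\<And>u v s. {u, v} \<in> E - F \<Longrightarrow> ((u, s), (v, \<not> s)) \<notin> (all_arcs (E - {{u, v}}))\<^sup>*"
proof -
  define Q where "Q F \<longleftrightarrow> F \<subseteq> E \<and> (\<exists>c. cyclic (arcs F c))" for F
  have "Q {}" by (auto simp: Q_def cyclic_def arcs_def)
  moreover have "\<forall>F. Q F \<longrightarrow> card F < Suc (card E)"
    using fin by (auto simp: Q_def less_Suc_eq_le card_mono)
  ultimately obtain F where F: "Q F" and max: "\<And>G. Q G \<Longrightarrow> card G \<le> card F"
    using ex_has_greatest_nat[of Q "{}" card] by blast
  obtain c where c: "F \<subseteq> E" "cyclic (arcs F c)" using F by (auto simp: Q_def)
  have "((u, s), (v, \<not> s)) \<notin> (all_arcs (E - {{u, v}}))\<^sup>*" if uv: "{u, v} \<in> E - F" for u v s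
  proof
    assume *: "((u, s), (v, \<not> s)) \<in> (all_arcs (E - {{u, v}}))\<^sup>*"
    let ?R = "arcs F c \<union> all_arcs (E - F - {{u, v}})"
    \<comment> \<open>Coloured steps of the odd walk are replaced by directed paths in the cyclic
      part and uncoloured steps keep both lifts, so the walk becomes a path of the kind from which
      the colouring can be extended.\<close>
    have "E - {{u, v}} = F \<union> (E - F - {{u, v}})" using uv c by auto
    then have "all_arcs (E - {{u, v}}) = all_arcs F \<union> all_arcs (E - F - {{u, v}})"
      by (metis all_arcs_Un)
    also have "\<dots> \<subseteq> ?R\<^sup>*"
      using all_arcs_subset_cyclic[OF c(2)] rtrancl_mono[of "arcs F c" ?R] by auto
    finally have "(all_arcs (E - {{u, v}}))\<^sup>* \<subseteq> ?R\<^sup>*" by (rule rtrancl_subset_rtrancl)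
    moreover have "((v, \<not> s), (u, s)) \<in> (all_arcs (E - {{u, v}}))\<^sup>*"
      using * by (rule sym_all_arcs_rtrancl)
    ultimately have "((v, \<not> s), (u, s)) \<in> ?R\<^sup>*" by blast
    from extend_cyclic_colouring[OF fin two c uv this]
    obtain F' c' where "F \<subset> F'" "F' \<subseteq> E" "cyclic (arcs F' c')" by blast
    then have "card F' \<le> card F" using max by (auto simp: Q_def)
    moreover have "card F < card F'"
      using \<open>F \<subset> F'\<close> \<open>F' \<subseteq> E\<close> fin finite_subset psubset_card_mono by blast
    ultimately show False by simp
  qed
  with c that show thesis by blast
qed

section \<open>Walks and stubborn edges\<close>

lemma walk_edges_Cons: "p \<noteq> [] \<Longrightarrow> walk_edges (x # p) = {x, hd p} # walk_edges p"
  by (cases p) auto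

text \<open>Each step negates the Boolean, so it records parity: a closed walk is odd exactly when
  it leads from a state to its flip.\<close>

lemma walk_imp_all_arcs:
  "p \<noteq> [] \<Longrightarrow> set (walk_edges p) \<subseteq> E \<Longrightarrow>
    ((hd p, s), (last p, s \<noteq> odd (walk_length p))) \<in> (all_arcs E)\<^sup>*"
proof (induction p arbitrary: s)
  case (Cons x p)
  show ?case
  proof (cases "p = []")
    case True
    then show ?thesis by (simp add: walk_length_def)
  next
    case False
    then have "((hd p, \<not> s), (last p, (\<not> s) \<noteq> odd (walk_length p))) \<in> (all_arcs E)\<^sup>*"
      using Cons.IH[of "\<not> s"] Cons.prems by (simp add: walk_edges_Cons)
    moreover have "((x, s), (hd p, \<not> s)) \<in> all_arcs E"
      using Cons False by (simp add: walk_edges_Cons all_arcs_iff)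
    ultimately show ?thesis
      using False by (auto simp: walk_length_def walk_edges_Cons intro: converse_rtrancl_into_rtrancl)
  qed
qed simp

lemma all_arcs_imp_walk:
  assumes "((u, s), (v, t)) \<in> (all_arcs E)\<^sup>*" and "\<forall>e\<in>E. e \<subseteq> V" and "v \<in> V"
  shows "\<exists>p. walk V E p \<and> hd p = u \<and> last p = v \<and> (odd (walk_length p) \<longleftrightarrow> s \<noteq> t)"
  using assms(1)
proof (induction "(u, s)" arbitrary: u s rule: converse_rtrancl_induct)
  case base
  show ?case using assms(3) by (intro exI[of _ "[v]"]) (auto simp: walk_def walk_length_def)
next
  case (step z)
  obtain w r where z: "z = (w, r)" by (cases z)
  obtain p where p: "walk V E p" "hd p = w" "last p = v" "odd (walk_length p) \<longleftrightarrow> r \<noteq> t"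
    using step(3)[OF z] by blast
  have "{u, w} \<in> E" "r = (\<not> s)" using step(1) by (auto simp: z all_arcs_iff)
  then show ?case
    using p assms(2)
    by (intro exI[of _ "u # p"]) (auto simp: walk_def walk_length_def walk_edges_Cons)
qed

lemma walk_imp_adj:
  assumes "p \<noteq> []" "set (walk_edges p) \<subseteq> E"
  shows "(hd p, last p) \<in> (adj E)\<^sup>*"
  using assms
proof (induction p)
  case (Cons x p)
  show ?case
  proof (cases "p = []")
    case False
    with Cons have "(x, hd p) \<in> adj E" "(hd p, last p) \<in> (adj E)\<^sup>*"
      by (auto simp: walk_edges_Cons adj_iff)
    then show ?thesis using False by (simp add: converse_rtrancl_into_rtrancl)
  qed simp
qed simp

lemma adj_imp_all_arcs:
  assumes "(u, v) \<in> (adj E)\<^sup>*"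
  shows "\<exists>t. ((u, s), (v, t)) \<in> (all_arcs E)\<^sup>*"
  using assms
proof (induction rule: rtrancl_induct)
  case (step y z)
  then obtain t where "((u, s), (y, t)) \<in> (all_arcs E)\<^sup>*" by blast
  moreover have "((y, t), (z, \<not> t)) \<in> all_arcs E" using step by (simp add: all_arcs_iff adj_iff)
  ultimately show ?case by (meson rtrancl.rtrancl_into_rtrancl)
qed auto

lemma joined_iff_adj:
  assumes "\<forall>e\<in>E. e \<subseteq> V" "v \<in> V"
  shows "joined V E u v \<longleftrightarrow> (u, v) \<in> (adj E)\<^sup>*"
proof
  assume "joined V E u v"
  then obtain p where "walk V E p" "hd p = u" "last p = v" by (auto simp: joined_def)
  then show "(u, v) \<in> (adj E)\<^sup>*" using walk_imp_adj[of p E] by (simp add: walk_def)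
next
  assume "(u, v) \<in> (adj E)\<^sup>*"
  from adj_imp_all_arcs[OF this, of True] obtain t where "((u, True), (v, t)) \<in> (all_arcs E)\<^sup>*" ..
  from all_arcs_imp_walk[OF this assms] show "joined V E u v" by (auto simp: joined_def)
qed

lemma adj_rtrancl_mono: "(u, v) \<in> (adj E)\<^sup>* \<Longrightarrow> E \<subseteq> E' \<Longrightarrow> (u, v) \<in> (adj E')\<^sup>*"
  using rtrancl_mono[OF adj_mono] by blast

lemma adj_rtrancl_in:
  assumes "(u, v) \<in> (adj E)\<^sup>*" "u \<in> V" "\<forall>e\<in>E. e \<subseteq> V"
  shows "v \<in> V"
  using assms by (induction rule: rtrancl_induct) (auto simp: adj_iff)

lemma two_colouring_if_no_odd_closed_walk:
  assumes "\<And>r. ((r, True), (r, False)) \<notin> (all_arcs E)\<^sup>*"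
  obtains \<phi> :: "'a \<Rightarrow> bool" where "\<And>a b. {a, b} \<in> E \<Longrightarrow> \<phi> a \<noteq> \<phi> b"
proof -
  \<comment> \<open>\<open>rep w\<close> depends only on the set of vertices reachable from
    \<open>w\<close>, so adjacent vertices share it; \<phi> asks whether some walk of even length
    leads from there to \<open>w\<close>.\<close>
  define rep where "rep w = (SOME x. (w, x) \<in> (adj E)\<^sup>*)" for w
  define \<phi> where "\<phi> w \<longleftrightarrow> ((rep w, True), (w, True)) \<in> (all_arcs E)\<^sup>*" for w
  have "\<phi> a \<noteq> \<phi> b" if ab: "{a, b} \<in> E" for a b
  proof -
    have "(a, b) \<in> (adj E)\<^sup>*" using ab by (auto simp: adj_iff)
    then have "(a, x) \<in> (adj E)\<^sup>* \<longleftrightarrow> (b, x) \<in> (adj E)\<^sup>*" for x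
      by (meson adj_rtrancl_sym rtrancl_trans)
    then have rep: "rep a = rep b" by (simp add: rep_def)
    have "(a, rep a) \<in> (adj E)\<^sup>*" unfolding rep_def by (rule someI[of _ a]) simp
    then have "(rep a, a) \<in> (adj E)\<^sup>*" by (rule adj_rtrancl_sym)
    from adj_imp_all_arcs[OF this] obtain t
      where t: "((rep a, True), (a, t)) \<in> (all_arcs E)\<^sup>*" by blast
    moreover have "((a, t), (b, \<not> t)) \<in> all_arcs E" using ab by (simp add: all_arcs_iff)
    ultimately have t': "((rep b, True), (b, \<not> t)) \<in> (all_arcs E)\<^sup>*"
      unfolding rep[symmetric] by (rule rtrancl.rtrancl_into_rtrancl)
    have no: "((w, False), (w, True)) \<notin> (all_arcs E)\<^sup>*" for w
      using assms[of w] sym_all_arcs_rtrancl by blast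
    have unique: "\<not> (((r, True), (w, True)) \<in> (all_arcs E)\<^sup>* \<and> ((r, True), (w, False)) \<in> (all_arcs E)\<^sup>*)"
      for r w
      using no[of w] rtrancl_trans[OF sym_all_arcs_rtrancl] by blast
    show ?thesis
      using t t' unique[of "rep a" a] unique[of "rep b" b] unfolding \<phi>_def by (cases t) auto
  qed
  then show thesis using that by blast
qed

lemma bipartite_if_two_colouring:
  fixes \<phi> :: "'a \<Rightarrow> bool"
  assumes "simple_graph V E" and "\<And>a b. {a, b} \<in> E \<Longrightarrow> \<phi> a \<noteq> \<phi> b"
  shows "bipartite V E"
  unfolding bipartite_def
proof (intro exI conjI ballI)
  show "{v \<in> V. \<phi> v} \<union> {v \<in> V. \<not> \<phi> v} = V" "{v \<in> V. \<phi> v} \<inter> {v \<in> V. \<not> \<phi> v} = {}" by auto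
  fix e assume "e \<in> E"
  then obtain a b where e: "e = {a, b}" "a \<in> V" "b \<in> V"
    using assms(1) by (fastforce simp: simple_graph_def card_2_iff)
  then have "\<phi> a \<noteq> \<phi> b" using assms(2) \<open>e \<in> E\<close> by auto
  then show "\<exists>x\<in>{v \<in> V. \<phi> v}. \<exists>y\<in>{v \<in> V. \<not> \<phi> v}. e = {x, y}"
    using e by (cases "\<phi> a") (auto simp: insert_commute)
qed

section \<open>Stubborn edges of a fixed connected non-bipartite graph\<close>

locale nonbipartite_graph =
  fixes V :: "'a set" and E :: "'a set set"
  assumes finite_V: "finite V"
    and simple: "simple_graph V E"
    and conn: "connected_graph V E"
    and nonbip: "\<not> bipartite V E"
begin

abbreviation S :: "'a set set" where "S \<equiv> stubborn_edges V E"

lemma edge_subset: "\<forall>e\<in>E. e \<subseteq> V"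
  using simple by (auto simp: simple_graph_def)

lemma edge_card: "\<forall>e\<in>E. card e = 2"
  using simple by (auto simp: simple_graph_def)

lemma finite_E: "finite E"
  using finite_V edge_subset by (meson Pow_iff finite_Pow_iff finite_subset subsetI)

lemma edge_in: "{a, b} \<in> E \<Longrightarrow> a \<in> V \<and> b \<in> V"
  using edge_subset by blast

lemma edgeE:
  assumes "e \<in> E"
  obtains a b where "e = {a, b}" "a \<noteq> b" "a \<in> V" "b \<in> V"
proof -
  obtain a b where "e = {a, b}" "a \<noteq> b" using assms edge_card by (auto simp: card_2_iff)
  moreover have "e \<subseteq> V" using assms edge_subset by blast
  ultimately show thesis using that by blast
qed

lemma all_joined: "u \<in> V \<Longrightarrow> v \<in> V \<Longrightarrow> (u, v) \<in> (adj E)\<^sup>*"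
  using conn joined_iff_adj[OF edge_subset] by (auto simp: connected_graph_def)

lemma stubborn_in: "e \<in> S \<Longrightarrow> e \<in> E"
  by (simp add: stubborn_edges_def)

lemma no_two_colouring:
  fixes \<phi> :: "'a \<Rightarrow> bool"
  shows "\<not> (\<forall>a b. {a, b} \<in> E \<longrightarrow> \<phi> a \<noteq> \<phi> b)"
  using bipartite_if_two_colouring[OF simple, of \<phi>] nonbip by blast

text \<open>Deleting \<open>e\<close> destroys all odd closed walks, so the rest is bipartite. A
  2-colouring of the rest cannot be proper at \<open>e\<close> as well, since the graph is not
  bipartite.\<close>

lemma stubborn_colouring:
  assumes "e \<in> S"
  obtains \<phi> :: "'a \<Rightarrow> bool" where "\<And>a b. {a, b} \<in> E \<Longrightarrow> (\<phi> a = \<phi> b) \<longleftrightarrow> {a, b} = e"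
proof -
  have "((r, True), (r, False)) \<notin> (all_arcs (E - {e}))\<^sup>*" for r
  proof
    assume *: "((r, True), (r, False)) \<in> (all_arcs (E - {e}))\<^sup>*"
    then have "r \<in> V"
    proof (cases rule: converse_rtranclE)
      case (step y)
      then show ?thesis using edge_in by (auto simp: all_arcs_def)
    qed simp
    from all_arcs_imp_walk[OF * _ this] edge_subset obtain p
      where "walk V (E - {e}) p" "hd p = r" "last p = r" "odd (walk_length p)" by auto
    then show False using assms by (auto simp: stubborn_edges_def closed_walk_def walk_def)
  qed
  then obtain \<phi> :: "'a \<Rightarrow> bool" where \<phi>: "\<And>a b. {a, b} \<in> E - {e} \<Longrightarrow> \<phi> a \<noteq> \<phi> b"
    using two_colouring_if_no_odd_closed_walk[of "E - {e}"] by blast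
  obtain x y where e: "e = {x, y}" using stubborn_in[OF assms] by (auto elim: edgeE)
  have "\<phi> x = \<phi> y"
  proof (rule ccontr)
    assume "\<phi> x \<noteq> \<phi> y"
    then have "\<phi> a \<noteq> \<phi> b" if "{a, b} \<in> E" for a b
      using \<phi>[of a b] that e by (cases "{a, b} = e") (auto simp: doubleton_eq_iff)
    then show False using no_two_colouring[of \<phi>] by blast
  qed
  then have "(\<phi> a = \<phi> b) \<longleftrightarrow> {a, b} = e" if "{a, b} \<in> E" for a b
    using \<phi>[of a b] that e by (auto simp: doubleton_eq_iff)
  then show thesis using that by blast
qed

text \<open>If \<open>e\<close> were the only edge leaving \<open>Z\<close>, switching its
  2-colouring on \<open>Z\<close> would repair the single fault at \<open>e\<close> and make the
  graph bipartite. In particular, a stubborn edge is never a bridge.\<close>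

lemma stubborn_not_only_boundary:
  assumes "e \<in> S" "z \<in> Z" "z \<in> V" "w \<in> V" "w \<notin> Z"
  shows "\<exists>a b. {a, b} \<in> E \<and> a \<in> Z \<and> b \<notin> Z \<and> {a, b} \<noteq> e"
proof (rule ccontr)
  assume "\<not> ?thesis"
  then have only: "\<And>a b. {a, b} \<in> E \<Longrightarrow> a \<in> Z \<Longrightarrow> b \<notin> Z \<Longrightarrow> {a, b} = e" by blast
  have "(z, w) \<in> (adj E)\<^sup>*" using all_joined assms by blast
  then have "\<exists>a b. {a, b} \<in> E \<and> a \<in> Z \<and> b \<notin> Z"
    using assms(2,5)
  proof (induction rule: rtrancl_induct)
    case (step y w)
    then show ?case by (cases "y \<in> Z") (auto simp: adj_iff)
  qed simp
  then obtain x y where xy: "{x, y} \<in> E" "x \<in> Z" "y \<notin> Z" by blast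
  then have e: "e = {x, y}" using only by blast
  obtain \<phi> :: "'a \<Rightarrow> bool" where \<phi>: "\<And>a b. {a, b} \<in> E \<Longrightarrow> (\<phi> a = \<phi> b) \<longleftrightarrow> {a, b} = e"
    using stubborn_colouring[OF assms(1)] by blast
  have "(\<phi> a \<noteq> (a \<in> Z)) \<noteq> (\<phi> b \<noteq> (b \<in> Z))" if "{a, b} \<in> E" for a b
  proof (cases "{a, b} = e")
    case True
    then show ?thesis using \<phi>[OF that] xy e by (auto simp: doubleton_eq_iff)
  next
    case False
    then have "a \<in> Z \<longleftrightarrow> b \<in> Z" using only that by (metis insert_commute)
    then show ?thesis using \<phi>[OF that] False by auto
  qed
  then show False using no_two_colouring[of "\<lambda>a. \<phi> a \<noteq> (a \<in> Z)"] by blast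
qed

text \<open>If the edge is neither, deleting it leaves a connected graph that still has an odd
  closed walk; a detour around this walk gives \<open>u\<close>-\<open>v\<close> walks of both
  parities.\<close>

lemma bridge_or_stubborn:
  assumes uv: "{u, v} \<in> E" and no: "\<And>s. ((u, s), (v, \<not> s)) \<notin> (all_arcs (E - {{u, v}}))\<^sup>*"
    and nb: "(u, v) \<in> (adj (E - {{u, v}}))\<^sup>*"
  shows "{u, v} \<in> S"
proof (rule ccontr)
  let ?E = "E - {{u, v}}"
  let ?U = "(all_arcs ?E)\<^sup>*"
  assume "{u, v} \<notin> S"
  then obtain p where p: "closed_walk V E p" "odd (walk_length p)" "{u, v} \<notin> set (walk_edges p)"
    using uv by (auto simp: stubborn_edges_def)
  define r where "r = hd p"
  have "set (walk_edges p) \<subseteq> ?E" "p \<noteq> []" "last p = r" "r \<in> V"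
    using p by (auto simp: closed_walk_def walk_def r_def)
  with walk_imp_all_arcs[of p ?E] p(2) have r: "((r, s), (r, \<not> s)) \<in> ?U" for s
    by (simp add: r_def)
  have "adj E \<subseteq> (adj ?E)\<^sup>*"
  proof clarify
    fix a b assume "(a, b) \<in> adj E"
    then show "(a, b) \<in> (adj ?E)\<^sup>*"
    proof (cases "{a, b} = {u, v}")
      case True
      then show ?thesis using nb adj_rtrancl_sym[OF nb] unfolding doubleton_eq_iff by blast
    next
      case False
      with \<open>(a, b) \<in> adj E\<close> have "(a, b) \<in> adj ?E" by (simp add: adj_iff)
      then show ?thesis by blast
    qed
  qed
  then have "(adj E)\<^sup>* \<subseteq> (adj ?E)\<^sup>*" by (rule rtrancl_subset_rtrancl)
  then have "(u, r) \<in> (adj ?E)\<^sup>*" using all_joined[of u r] edge_in[OF uv] \<open>r \<in> V\<close> by blast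
  from adj_imp_all_arcs[OF this, of True] obtain t where t: "((u, True), (r, t)) \<in> ?U" ..
  \<comment> \<open>The way from \<open>u\<close> to \<open>r\<close> is walked back as its skew
    image, so the odd closed walk at \<open>r\<close> becomes a change of state at
    \<open>u\<close>.\<close>
  from skew_rtrancl[OF skew_all_arcs t] have "((r, \<not> t), (u, False)) \<in> ?U" by simp
  with t r have u: "((u, True), (u, False)) \<in> ?U" by (meson rtrancl_trans)
  from adj_imp_all_arcs[OF nb, of False] obtain t'' where t'': "((u, False), (v, t'')) \<in> ?U" ..
  have "\<not> t''" using t'' no[of False] by (cases t'') simp_all
  then have "((u, True), (v, \<not> True)) \<in> ?U" using rtrancl_trans[OF u t''] by simp
  then show False using no by blast
qed

end

section \<open>Properly coloured walks as directed walks in the double cover\<close>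

lemma proper_walk_imp_arcs:
  assumes "p \<noteq> []" "set (walk_edges p) \<subseteq> E" "properly_coloured c p"
    and col: "\<forall>e\<in>E. c e \<in> {1, 2::nat}"
    and "walk_edges p \<noteq> [] \<Longrightarrow> s \<longleftrightarrow> c (hd (walk_edges p)) = 1"
  shows "\<exists>t. ((hd p, s), (last p, t)) \<in> (arcs E (\<lambda>e. c e = 1))\<^sup>*"
  using assms(1-3,5)
proof (induction p arbitrary: s)
  case (Cons x p)
  show ?case
  proof (cases "p = []")
    case True
    then show ?thesis by auto
  next
    case False
    have s: "s \<longleftrightarrow> c {x, hd p} = 1" using Cons.prems False by (simp add: walk_edges_Cons)
    have pc: "successively (\<lambda>e f. c e \<noteq> c f) ({x, hd p} # walk_edges p)"
      and sub: "{x, hd p} \<in> E" "set (walk_edges p) \<subseteq> E"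
      using Cons.prems False by (auto simp: walk_edges_Cons properly_coloured_def)
    have "(\<not> s) \<longleftrightarrow> c (hd (walk_edges p)) = 1" if ne: "walk_edges p \<noteq> []"
    proof -
      have "c {x, hd p} \<noteq> c (hd (walk_edges p))" using pc ne by (simp add: successively_Cons)
      moreover have "c (hd (walk_edges p)) \<in> {1, 2}" "c {x, hd p} \<in> {1, 2}"
        using col sub ne by (meson hd_in_set subsetD)+
      ultimately show ?thesis using s by auto
    qed
    moreover have "properly_coloured c p"
      using pc by (auto simp: properly_coloured_def successively_Cons)
    ultimately obtain t where t: "((hd p, \<not> s), (last p, t)) \<in> (arcs E (\<lambda>e. c e = 1))\<^sup>*"
      using Cons.IH[of "\<not> s"] False sub by blast
    have "((x, s), (hd p, \<not> s)) \<in> arcs E (\<lambda>e. c e = 1)" using sub s by (simp add: arcs_iff)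
    with t show ?thesis using False by (auto intro: converse_rtrancl_into_rtrancl)
  qed
qed simp

text \<open>The last conjunct carries the induction: the walk obtained starts with colour
  \<open>s\<close>, so an edge of the opposite colour can be put in front of it.\<close>

lemma arcs_imp_proper_walk:
  assumes "((u, s), (v, t)) \<in> (arcs E c)\<^sup>*" and "\<forall>e\<in>E. e \<subseteq> V" and "v \<in> V"
  shows "\<exists>p. walk V E p \<and> hd p = u \<and> last p = v \<and>
    properly_coloured (\<lambda>e. if c e then 1 else 2) p \<and>
    (walk_edges p \<noteq> [] \<longrightarrow> c (hd (walk_edges p)) = s)"
  using assms(1)
proof (induction "(u, s)" arbitrary: u s rule: converse_rtrancl_induct)
  case base
  show ?case
    using assms(3) by (intro exI[of _ "[v]"]) (auto simp: walk_def properly_coloured_def)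
next
  case (step z)
  obtain w r where z: "z = (w, r)" by (cases z)
  obtain p where p: "walk V E p" "hd p = w" "last p = v"
    "properly_coloured (\<lambda>e. if c e then 1 else 2) p"
    "walk_edges p \<noteq> [] \<longrightarrow> c (hd (walk_edges p)) = r"
    using step(3)[OF z] by blast
  have "{u, w} \<in> E" "c {u, w} = s" "r = (\<not> s)" using step(1) by (auto simp: z arcs_iff)
  then show ?case
    using p assms(2)
    by (intro exI[of _ "u # p"])
      (auto simp: walk_def walk_edges_Cons properly_coloured_def successively_Cons)
qed

section \<open>From a colouring to a component\<close>

lemma finite_total_preorder_least:
  assumes "finite L" "L \<noteq> {}" "\<And>u v. u \<in> L \<Longrightarrow> v \<in> L \<Longrightarrow> (u, v) \<in> R\<^sup>* \<or> (v, u) \<in> R\<^sup>*"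
  shows "\<exists>a\<in>L. \<forall>u\<in>L. (a, u) \<in> R\<^sup>*"
  using assms
proof (induction rule: finite_ne_induct)
  case (insert x L)
  then obtain a where a: "a \<in> L" "\<forall>u\<in>L. (a, u) \<in> R\<^sup>*" by blast
  have "(a, x) \<in> R\<^sup>* \<or> (x, a) \<in> R\<^sup>*" using insert.prems a by blast
  then show ?case
  proof
    assume "(a, x) \<in> R\<^sup>*"
    then show ?thesis using a by blast
  next
    assume xa: "(x, a) \<in> R\<^sup>*"
    then have "\<forall>u\<in>L. (x, u) \<in> R\<^sup>*" using a by (meson rtrancl_trans)
    then show ?thesis by blast
  qed
qed auto

lemma set_mset_mset_set_remove:
  "finite E \<Longrightarrow> g \<in> E \<Longrightarrow> set_mset (mset_set E - {#g#}) = E - {g}"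
  by (simp add: mset_set.remove)

text \<open>The extra edge joins a vertex that reaches everything to one that everything reaches:
  each bridge lies between them.\<close>

lemma two_edge_connectable_if_unilateral:
  assumes fin: "finite L" "finite E" and ne: "L \<noteq> {}" and sub: "\<forall>e\<in>E. e \<subseteq> L"
    and ori: "R \<subseteq> adj E" and asym: "\<And>u v. (u, v) \<in> R \<Longrightarrow> (v, u) \<notin> R"
    and total: "\<And>u v. u \<in> L \<Longrightarrow> v \<in> L \<Longrightarrow> (u, v) \<in> R\<^sup>* \<or> (v, u) \<in> R\<^sup>*"
  shows "two_edge_connectable L E"
proof -
  obtain a where a: "a \<in> L" "\<forall>u\<in>L. (a, u) \<in> R\<^sup>*"
    using finite_total_preorder_least[OF fin(1) ne total] by blast
  have "\<exists>b\<in>L. \<forall>u\<in>L. (b, u) \<in> (R\<inverse>)\<^sup>*"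
    by (rule finite_total_preorder_least[OF fin(1) ne]) (use total in \<open>auto simp: rtrancl_converse\<close>)
  then obtain b where b: "b \<in> L" "\<forall>u\<in>L. (u, b) \<in> R\<^sup>*" by (auto simp: rtrancl_converse)
  have RE: "(u, v) \<in> R\<^sup>* \<Longrightarrow> (u, v) \<in> (adj E)\<^sup>*" for u v
    using rtrancl_mono[OF ori] by blast
  have conn: "(u, v) \<in> (adj E)\<^sup>*" if "u \<in> L" "v \<in> L" for u v
    using total[OF that] RE[of u v] adj_rtrancl_sym[OF RE[of v u]] by auto
  have connected: "connected_graph L E'" if "E \<subseteq> E'" "\<forall>e\<in>E'. e \<subseteq> L" for E'
    unfolding connected_graph_def
    using ne joined_iff_adj[OF that(2)] adj_rtrancl_mono[OF conn that(1)] by simp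
  \<comment> \<open>The opposite arc is absent from \<open>R\<close>. Hence a path to
    \<open>x\<close> may be stopped before its first use of the arc (x, y), and a path from
    \<open>y\<close> may be started after its last use.\<close>
  have dir: "(a, x) \<in> (adj (E - {{x, y}}))\<^sup>* \<and> (y, b) \<in> (adj (E - {{x, y}}))\<^sup>*"
    if "(x, y) \<in> R" and no: "(x, y) \<notin> (adj (E - {{x, y}}))\<^sup>*" and "x \<in> L" "y \<in> L" for x y
  proof -
    let ?A = "adj (E - {{x, y}})"
    have "R \<subseteq> insert (x, y) ?A"
    proof clarify
      fix u v assume uv: "(u, v) \<in> R" "(u, v) \<notin> ?A"
      then have "{u, v} = {x, y}" using ori by (auto simp: adj_iff)
      then show "u = x \<and> v = y" using uv asym[OF that(1)] by (auto simp: doubleton_eq_iff)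
    qed
    then have "R\<^sup>* \<subseteq> (insert (x, y) ?A)\<^sup>*" by (rule rtrancl_mono)
    then have "(a, x) \<in> (insert (x, y) ?A)\<^sup>*" "(y, b) \<in> (insert (x, y) ?A)\<^sup>*"
      using a b that by blast+
    moreover have "(y, x) \<notin> ?A\<^sup>*" using no adj_rtrancl_sym[of y x] by auto
    ultimately show ?thesis by (auto simp: rtrancl_insert_iff)
  qed
  have key: "((a, x) \<in> (adj (E - {{x, y}}))\<^sup>* \<and> (y, b) \<in> (adj (E - {{x, y}}))\<^sup>*) \<or>
      ((a, y) \<in> (adj (E - {{x, y}}))\<^sup>* \<and> (x, b) \<in> (adj (E - {{x, y}}))\<^sup>*)"
    if xy: "{x, y} \<in> E" and no: "(x, y) \<notin> (adj (E - {{x, y}}))\<^sup>*" for x y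
  proof -
    have L: "x \<in> L" "y \<in> L" using xy sub by auto
    \<comment> \<open>A bridge that \<open>R\<close> does not orient would leave its two ends
      incomparable.\<close>
    have "(x, y) \<in> R \<or> (y, x) \<in> R"
    proof (rule ccontr)
      assume none: "\<not> ?thesis"
      have "R \<subseteq> adj (E - {{x, y}})"
      proof clarify
        fix u v assume uv: "(u, v) \<in> R"
        then have "{u, v} \<in> E" "{u, v} \<noteq> {x, y}"
          using ori none by (auto simp: adj_iff doubleton_eq_iff)
        then show "(u, v) \<in> adj (E - {{x, y}})" by (simp add: adj_iff)
      qed
      then have "R\<^sup>* \<subseteq> (adj (E - {{x, y}}))\<^sup>*" by (rule rtrancl_mono)
      then show False using total[OF L] no adj_rtrancl_sym[of y x] by auto
    qed
    then show ?thesis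
    proof
      assume "(x, y) \<in> R"
      from dir[OF this no L] show ?thesis ..
    next
      assume "(y, x) \<in> R"
      moreover have "(y, x) \<notin> (adj (E - {{y, x}}))\<^sup>*"
        using no adj_rtrancl_sym[of y x] by (auto simp: insert_commute)
      ultimately show ?thesis using dir[of y x] L by (simp add: insert_commute)
    qed
  qed
  show ?thesis
  proof (cases "\<forall>e. \<not> bridge L (mset_set E) e")
    case True
    then show ?thesis
      using connected[OF subset_refl sub] fin
      by (simp add: two_edge_connectable_def two_edge_connected_def)
  next
    case False
    then obtain f x y where f: "f \<in> E" "f = {x, y}" "\<not> joined L (E - {f}) x y"
      using fin by (auto simp: bridge_def set_mset_mset_set_remove)
    have "x \<in> L" "y \<in> L" using f sub by auto
    then have no: "(x, y) \<notin> (adj (E - {{x, y}}))\<^sup>*"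
      using f joined_iff_adj[of "E - {f}" L y x] sub by auto
    \<comment> \<open>If \<open>a\<close> and \<open>b\<close> coincided, the two ends of the bridge
      would be joined through \<open>a\<close>. Distinctness makes {a, b} an admissible edge, as
      loops are excluded.\<close>
    have "a \<noteq> b"
    proof
      assume "a = b"
      then have "(x, y) \<in> (adj (E - {{x, y}}))\<^sup>* \<or> (y, x) \<in> (adj (E - {{x, y}}))\<^sup>*"
        using key[of x y] f no adj_rtrancl_sym[of b x] adj_rtrancl_sym[of b y]
        by (meson rtrancl_trans adj_rtrancl_sym)
      then show False using no adj_rtrancl_sym[of y x] by auto
    qed
    let ?e = "{a, b}"
    let ?M = "add_mset ?e (mset_set E)"
    have "\<not> bridge L ?M g" for g
    proof
      assume "bridge L ?M g"
      then obtain x y where g: "g \<in># ?M" "g = {x, y}" "\<not> joined L (set_mset (?M - {#g#})) x y"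
        by (auto simp: bridge_def)
      have gE: "g = ?e \<or> g \<in> E" using g fin by auto
      then have xy: "x \<in> L" "y \<in> L" using g a b sub by auto
      show False
      proof (cases "g = ?e")
        case True
        \<comment> \<open>This covers a new edge parallel to an old one: removing one copy leaves
          exactly \<open>E\<close> in either case.\<close>
        then have "set_mset (?M - {#g#}) = E" using fin by simp
        then show False using g(3) conn[OF xy] joined_iff_adj[OF sub xy(2)] by simp
      next
        case False
        then have "g \<in> E" using gE by blast
        then have eq: "set_mset (?M - {#g#}) = insert ?e (E - {g})"
          using False fin by (simp add: set_mset_mset_set_remove)
        have "\<forall>e\<in>insert ?e (E - {g}). e \<subseteq> L" using sub a b by auto
        then have no: "(x, y) \<notin> (adj (insert ?e (E - {g})))\<^sup>*"
          using g(3) eq xy joined_iff_adj[of "insert ?e (E - {g})" L y x] by simp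
        have up: "(u, v) \<in> (adj (E - {{x, y}}))\<^sup>* \<Longrightarrow> (u, v) \<in> (adj (insert ?e (E - {g})))\<^sup>*" for u v
          using adj_rtrancl_mono[of u v "E - {{x, y}}"] g(2) by blast
        let ?F = "insert ?e (E - {g})"
        have ab: "(a, b) \<in> (adj ?F)\<^sup>*" by (intro r_into_rtrancl) (simp add: adj_iff)
        have "(x, y) \<notin> (adj (E - {{x, y}}))\<^sup>*" using no up by blast
        then consider "(x, a) \<in> (adj ?F)\<^sup>*" "(b, y) \<in> (adj ?F)\<^sup>*"
          | "(y, a) \<in> (adj ?F)\<^sup>*" "(b, x) \<in> (adj ?F)\<^sup>*"
          using key[of x y] \<open>g \<in> E\<close> g(2) up adj_rtrancl_sym[of _ _ ?F] by blast
        then show False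
        proof cases
          case 1
          then have "(x, y) \<in> (adj ?F)\<^sup>*" using ab by (meson rtrancl_trans)
          then show False using no by blast
        next
          case 2
          then have "(y, x) \<in> (adj ?F)\<^sup>*" using ab by (meson rtrancl_trans)
          then show False using no adj_rtrancl_sym[of y x] by simp
        qed
      qed
    qed
    moreover have "connected_graph L (set_mset ?M)"
      by (rule connected) (use fin sub a b in auto)
    ultimately have "two_edge_connected L ?M" by (simp add: two_edge_connected_def)
    moreover have "?e \<subseteq> L" "card ?e = 2" using a b \<open>a \<noteq> b\<close> by auto
    ultimately show ?thesis unfolding two_edge_connectable_def by blast
  qed
qed

section \<open>Cuts of two stubborn edges and their trapping side\<close>

context nonbipartite_graph
begin

lemma component_eq:
  "r \<in> V \<Longrightarrow> {v \<in> V. joined V (E - S) r v} = {v. (r, v) \<in> (adj (E - S))\<^sup>*}"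
proof -
  assume r: "r \<in> V"
  have sub: "\<forall>e\<in>E - S. e \<subseteq> V" using edge_subset by blast
  show ?thesis using joined_iff_adj[OF sub] adj_rtrancl_in[OF _ r sub] by blast
qed

text \<open>Every edge leaving \<open>K\<close> is stubborn, because \<open>K\<close> is closed
  under the others, and a stubborn edge is never the only one that leaves a set.\<close>

lemma component_boundary:
  assumes K: "K \<in> stubborn_free_components V E" and ne: "V - K \<noteq> {}"
  obtains x x' y y' where "{x, x'} \<in> S" "{y, y'} \<in> S" "{x, x'} \<noteq> {y, y'}"
    "x \<in> K" "y \<in> K" "x' \<in> V - K" "y' \<in> V - K"
proof -
  obtain r where r: "r \<in> V" "K = {v. (r, v) \<in> (adj (E - S))\<^sup>*}"
    using K component_eq by (auto simp: stubborn_free_components_def components_def)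
  obtain w where w: "w \<in> V" "w \<notin> K" using ne by blast
  have cross: "{a, b} \<in> S" if "{a, b} \<in> E" "a \<in> K" "b \<notin> K" for a b
  proof (rule ccontr)
    assume "{a, b} \<notin> S"
    then have "(a, b) \<in> adj (E - S)" using that by (simp add: adj_iff)
    then show False using that(2,3) unfolding r by (auto intro: rtrancl.rtrancl_into_rtrancl)
  qed
  have rK: "r \<in> K" using r by auto
  have "(r, w) \<in> (adj E)\<^sup>*" using all_joined r w by blast
  then have "\<exists>a b. {a, b} \<in> E \<and> a \<in> K \<and> b \<notin> K"
    using rK w(2)
  proof (induction rule: rtrancl_induct)
    case (step y z)
    then show ?case by (cases "y \<in> K") (auto simp: adj_iff)
  qed simp
  then obtain x x' where x: "{x, x'} \<in> E" "x \<in> K" "x' \<notin> K" by blast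
  then have xS: "{x, x'} \<in> S" using cross by blast
  obtain y y' where y: "{y, y'} \<in> E" "y \<in> K" "y' \<notin> K" "{y, y'} \<noteq> {x, x'}"
    using stubborn_not_only_boundary[OF xS rK r(1) w] by blast
  have "{y, y'} \<in> S" using cross y by blast
  then show thesis using that[OF xS, of y y'] x y edge_in[OF x(1)] edge_in[OF y(1)] by auto
qed

lemma normalised_stubborn_colouring:
  assumes "e \<in> S"
  shows "\<exists>\<phi> :: 'a \<Rightarrow> bool. (\<forall>a b. {a, b} \<in> E \<longrightarrow> (\<phi> a = \<phi> b) = ({a, b} = e)) \<and> (\<forall>x\<in>e. \<phi> x = s)"
proof -
  obtain \<phi> :: "'a \<Rightarrow> bool" where \<phi>: "\<And>a b. {a, b} \<in> E \<Longrightarrow> (\<phi> a = \<phi> b) \<longleftrightarrow> {a, b} = e"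
    using stubborn_colouring[OF assms] by blast
  obtain x y where e: "e = {x, y}" using stubborn_in[OF assms] by (auto elim: edgeE)
  have "{x, y} \<in> E" using stubborn_in[OF assms] e by simp
  with \<phi> e have xy: "\<phi> x = \<phi> y" by blast
  show ?thesis
  proof (cases "\<phi> x = s")
    case True
    then show ?thesis using \<phi> xy e by (intro exI[of _ \<phi>]) auto
  next
    case False
    then show ?thesis using \<phi> xy e by (intro exI[of _ "\<lambda>a. \<not> \<phi> a"]) auto
  qed
qed

theorem stubborn_free_component_if_colouring:
  assumes pc: "\<And>u v. u \<in> V \<Longrightarrow> v \<in> V \<Longrightarrow> \<exists>s t. ((u, s), (v, t)) \<in> (arcs E c)\<^sup>*"
  shows "\<exists>K \<in> stubborn_free_components V E.
      V - K = {} \<or> two_edge_connectable (V - K) (induced_edges E (V - K))"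
proof (cases "\<exists>e\<in>S. \<exists>e'\<in>S. e \<noteq> e'")
  case False
  obtain r where "r \<in> V" using conn by (auto simp: connected_graph_def)
  then obtain K where K: "K \<in> stubborn_free_components V E"
    by (auto simp: stubborn_free_components_def components_def)
  have "V - K = {}"
  proof (rule ccontr)
    assume "V - K \<noteq> {}"
    then obtain x x' y y' where "{x, x'} \<in> S" "{y, y'} \<in> S" "{x, x'} \<noteq> {y, y'}"
      by (rule component_boundary[OF K])
    then show False using False by metis
  qed
  then show ?thesis using K by blast
next
  case True
  \<comment> \<open>Negating a colouring keeps its fault, so its value on the ends of
    \<open>e\<close> can be prescribed. Taking the colour \<open>c e\<close> determines which side
    of each two-edge cut is called \<open>A\<close> below, namely the one that traps walks.\<close>
  have "\<forall>e\<in>S. \<exists>\<phi> :: 'a \<Rightarrow> bool.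
      (\<forall>a b. {a, b} \<in> E \<longrightarrow> (\<phi> a = \<phi> b) = ({a, b} = e)) \<and> (\<forall>x\<in>e. \<phi> x = c e)"
    by (intro ballI normalised_stubborn_colouring)
  from bchoice[OF this] obtain \<Phi> :: "'a set \<Rightarrow> 'a \<Rightarrow> bool" where
    \<Phi>S: "\<forall>e\<in>S. (\<forall>a b. {a, b} \<in> E \<longrightarrow> (\<Phi> e a = \<Phi> e b) = ({a, b} = e)) \<and> (\<forall>x\<in>e. \<Phi> e x = c e)" ..
  have \<Phi>: "(\<Phi> e a = \<Phi> e b) = ({a, b} = e)" if "e \<in> S" "{a, b} \<in> E" for e a b
    using \<Phi>S that by simp
  have \<Phi>c: "\<Phi> e x = c e" if "e \<in> S" "x \<in> e" for e x
    using \<Phi>S that by simp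
  \<comment> \<open>Along an edge other than \<open>e\<close> and \<open>e'\<close> both colourings
    change, along \<open>e\<close> or \<open>e'\<close> exactly one does. So the set on which they
    agree has precisely \<open>e\<close> and \<open>e'\<close> as its boundary.\<close>
  define A where "A e e' = {u \<in> V. \<Phi> e u = \<Phi> e' u}" for e e'
  define Q where "Q = (\<lambda>(e, e'). e \<in> S \<and> e' \<in> S \<and> e \<noteq> e')"
  obtain q0 where "Q q0" using True by (auto simp: Q_def)
  then obtain e e' where ee': "Q (e, e')"
    and min: "\<And>g h. Q (g, h) \<Longrightarrow> card (A e e') \<le> card (A g h)"
    using ex_has_least_nat[of Q q0 "\<lambda>(e, e'). card (A e e')"] by force
  have e: "e \<in> S" and e': "e' \<in> S" and ne: "e \<noteq> e'" using ee' by (auto simp: Q_def)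
  have finA: "finite (A g h)" for g h using finite_V by (simp add: A_def)
  define B where "B = A e e'"
  have ends: "\<exists>x x'. g = {x, x'} \<and> x \<in> B \<and> x' \<in> V - B" if g: "g = e \<or> g = e'" for g
  proof -
    have "g \<in> E" using g e e' stubborn_in by blast
    then obtain x x' where x: "g = {x, x'}" "x \<in> V" "x' \<in> V" by (auto elim: edgeE)
    have "{x, x'} \<in> E" using \<open>g \<in> E\<close> x by simp
    then have "x \<in> B \<longleftrightarrow> x' \<notin> B"
      using \<Phi>[OF e, of x x'] \<Phi>[OF e', of x x'] x g ne by (auto simp: B_def A_def)
    then show ?thesis using x by (cases "x \<in> B") (auto simp: insert_commute)
  qed
  obtain x x' where x: "e = {x, x'}" "x \<in> B" "x' \<in> V - B" using ends by blast
  obtain y y' where y: "e' = {y, y'}" "y \<in> B" "y' \<in> V - B" using ends by blast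
  have xE: "{x, x'} \<in> E" and yE: "{y, y'} \<in> E" using stubborn_in e e' x y by auto
  have cross: "{a, b} = e \<or> {a, b} = e'" if "{a, b} \<in> E" "a \<in> B" "b \<notin> B" for a b
    using \<Phi>[OF e that(1)] \<Phi>[OF e' that(1)] that edge_in[OF that(1)] by (auto simp: B_def A_def)
  \<comment> \<open>A stubborn edge g inside B would split the graph along three stubborn edges into the four
    cells of P; either some cell is attached by g alone, or one cell is empty and g cuts
    B into two sides, one of which is a smaller A e' g or A e g.\<close>
  have inside: "{a, b} \<notin> S" if abE: "{a, b} \<in> E" and ab: "a \<in> B" "b \<in> B" for a b
  proof
    assume g: "{a, b} \<in> S"
    define g where "g = {a, b}"
    have gS: "g \<in> S" using g by (simp add: g_def)
    have ge: "g \<noteq> e" "g \<noteq> e'" using x y ab by (auto simp: g_def doubleton_eq_iff)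
    have V: "x \<in> V" "x' \<in> V" "y \<in> V" "y' \<in> V" "a \<in> V" "b \<in> V"
      using edge_in xE yE abE by blast+
    note flips = \<Phi>[OF e] \<Phi>[OF e'] \<Phi>[OF gS]
    have xs: "\<Phi> e x = \<Phi> e x'" "\<Phi> e' x \<noteq> \<Phi> e' x'" "\<Phi> g x \<noteq> \<Phi> g x'" "\<Phi> e x = \<Phi> e' x"
      using flips[OF xE] x ne ge by (auto simp: B_def A_def)
    have ys: "\<Phi> e y \<noteq> \<Phi> e y'" "\<Phi> e' y = \<Phi> e' y'" "\<Phi> g y \<noteq> \<Phi> g y'" "\<Phi> e y = \<Phi> e' y"
      using flips[OF yE] y ne ge by (auto simp: B_def A_def)
    have as: "\<Phi> e a \<noteq> \<Phi> e b" "\<Phi> e' a \<noteq> \<Phi> e' b" "\<Phi> g a = \<Phi> g b" "\<Phi> e a = \<Phi> e' a" "\<Phi> e b = \<Phi> e' b"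
      using flips[OF abE] ge ab by (auto simp: B_def A_def g_def)
    \<comment> \<open>Passing \<open>g\<close> changes only the second entry of \<open>P\<close>,
      passing \<open>e'\<close> only the first, passing \<open>e\<close> both. The cells with first
      entry \<open>True\<close> make up \<open>B\<close>, and the positions of \<open>x\<close> and
      \<open>y\<close> decide which cells \<open>e\<close> and \<open>e'\<close> join.\<close>
    define P where "P w = (\<Phi> e w = \<Phi> e' w, \<Phi> e w = \<Phi> g w)" for w
    have stay: "P p = P q" if "{p, q} \<in> E" "{p, q} \<noteq> e" "{p, q} \<noteq> e'" "{p, q} \<noteq> g" for p q
      using flips[OF that(1)] that(2-4) by (auto simp: P_def)
    have gP: "{P a, P b} = {(True, True), (True, False)}"
      using as by (auto simp: P_def)
    have no: False if Z: "\<exists>z\<in>V. P z = k" "\<exists>z\<in>V. P z \<noteq> k" and h: "h \<in> S"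
      and bd: "\<And>p q. {p, q} \<in> {e, e', g} \<Longrightarrow> {p, q} \<noteq> h \<Longrightarrow> P p = k \<Longrightarrow> P q = k" for k h
    proof -
      obtain z w where "z \<in> V" "P z = k" "w \<in> V" "P w \<noteq> k" using Z by blast
      then obtain p q where pq: "{p, q} \<in> E" "P p = k" "P q \<noteq> k" "{p, q} \<noteq> h"
        using stubborn_not_only_boundary[OF h, of z "{z. P z = k}" w] by auto
      show False using stay[of p q] bd[of p q] pq by auto
    qed
    have pair: "{p, q} = {r, t} \<Longrightarrow> P r \<noteq> k \<Longrightarrow> P t \<noteq> k \<Longrightarrow> P p \<noteq> k" for p q r t k
      by (auto simp: doubleton_eq_iff)
    have abP: "\<exists>z\<in>V. P z = (True, True)" "\<exists>z\<in>V. P z = (True, False)"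
      using gP V by (auto simp: doubleton_eq_iff)
    have abQ: "\<exists>z\<in>V. P z \<noteq> k" for k
    proof -
      have "P a \<noteq> P b" using gP by (auto simp: doubleton_eq_iff)
      then show ?thesis using V(5,6) by metis
    qed
    show False
    proof (cases "\<Phi> e x = \<Phi> g x"; cases "\<Phi> e y = \<Phi> g y")
      \<comment> \<open>Both cut edges are attached to the cell (True, True), which leaves
        \<open>g\<close> as the only edge at (True, False). The next case is its mirror
        image.\<close>
      assume c: "\<Phi> e x = \<Phi> g x" "\<Phi> e y = \<Phi> g y"
      show False
      proof (rule no[of "(True, False)" g])
        fix p q assume pq: "{p, q} \<in> {e, e', g}" "{p, q} \<noteq> g" "P p = (True, False)"
        then have "{p, q} = {x, x'} \<or> {p, q} = {y, y'}" using x y by blast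
        then show "P q = (True, False)"
          using pair[of p q x x' "(True, False)"] pair[of p q y y' "(True, False)"] pq(3) c xs ys
          by (auto simp: P_def)
      qed (use abP abQ gS in blast)+
    next
      assume c: "\<Phi> e x \<noteq> \<Phi> g x" "\<Phi> e y \<noteq> \<Phi> g y"
      show False
      proof (rule no[of "(True, True)" g])
        fix p q assume pq: "{p, q} \<in> {e, e', g}" "{p, q} \<noteq> g" "P p = (True, True)"
        then have "{p, q} = {x, x'} \<or> {p, q} = {y, y'}" using x y by blast
        then show "P q = (True, True)"
          using pair[of p q x x' "(True, True)"] pair[of p q y y' "(True, True)"] pq(3) c xs ys
          by (auto simp: P_def)
      qed (use abP abQ gS in blast)+
    next
      \<comment> \<open>No edge leaves the cell (False, False), so it is empty and
        \<open>A e' g\<close> shrinks to the cell (True, True), a proper part of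
        \<open>B\<close>.\<close>
      assume c: "\<Phi> e x \<noteq> \<Phi> g x" "\<Phi> e y = \<Phi> g y"
      have none: "P z \<noteq> (False, False)" if "z \<in> V" for z
      proof
        assume z: "P z = (False, False)"
        show False
        proof (rule no[of "(False, False)" g])
          fix p q assume pq: "{p, q} \<in> {e, e', g}" "{p, q} \<noteq> g" "P p = (False, False)"
          then have "{p, q} = {x, x'} \<or> {p, q} = {y, y'}" using x y by blast
          then show "P q = (False, False)"
            using pair[of p q x x' "(False, False)"] pair[of p q y y' "(False, False)"] pq(3) c xs ys
            by (auto simp: P_def)
        qed (use abP abQ gS z that in blast)+
      qed
      have "A e' g \<subset> A e e'"
      proof
        show "A e' g \<subseteq> A e e'" using none by (auto simp: A_def P_def)
        show "A e' g \<noteq> A e e'"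
        proof -
          obtain z where z: "z \<in> V" "P z = (True, False)" using abP by blast
          then have "z \<in> A e e'" "z \<notin> A e' g" by (auto simp: A_def P_def)
          then show ?thesis by blast
        qed
      qed
      then have "card (A e' g) < card (A e e')" using finA psubset_card_mono by blast
      then show False using min[of e' g] e' gS ge by (auto simp: Q_def)
    next
      \<comment> \<open>Now (False, True) is the empty cell, and \<open>A e g\<close> shrinks to
        (True, True).\<close>
      assume c: "\<Phi> e x = \<Phi> g x" "\<Phi> e y \<noteq> \<Phi> g y"
      have none: "P z \<noteq> (False, True)" if "z \<in> V" for z
      proof
        assume z: "P z = (False, True)"
        show False
        proof (rule no[of "(False, True)" g])
          fix p q assume pq: "{p, q} \<in> {e, e', g}" "{p, q} \<noteq> g" "P p = (False, True)"
          then have "{p, q} = {x, x'} \<or> {p, q} = {y, y'}" using x y by blast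
          then show "P q = (False, True)"
            using pair[of p q x x' "(False, True)"] pair[of p q y y' "(False, True)"] pq(3) c xs ys
            by (auto simp: P_def)
        qed (use abP abQ gS z that in blast)+
      qed
      have "A e g \<subset> A e e'"
      proof
        show "A e g \<subseteq> A e e'" using none by (auto simp: A_def P_def)
        show "A e g \<noteq> A e e'"
        proof -
          obtain z where z: "z \<in> V" "P z = (True, False)" using abP by blast
          then have "z \<in> A e e'" "z \<notin> A e g" by (auto simp: A_def P_def)
          then show ?thesis by blast
        qed
      qed
      then have "card (A e g) < card (A e e')" using finA psubset_card_mono by blast
      then show False using min[of e g] e gS ge by (auto simp: Q_def)
    qed
  qed
  have BV: "B \<subseteq> V" by (auto simp: B_def A_def)
  define K where "K = {v. (x, v) \<in> (adj (E - S))\<^sup>*}"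
  have xV: "x \<in> V" using x BV by blast
  have KS: "K \<in> stubborn_free_components V E"
    using component_eq[OF xV] xV by (auto simp: K_def stubborn_free_components_def components_def)
  have KB: "K \<subseteq> B"
  proof
    fix v assume "v \<in> K"
    then have "(x, v) \<in> (adj (E - S))\<^sup>*" by (simp add: K_def)
    then show "v \<in> B"
    proof (induction rule: rtrancl_induct)
      case (step p q)
      then have "{p, q} \<in> E" "{p, q} \<notin> S" by (auto simp: adj_iff)
      then show ?case using cross[of p q] step e e' by blast
    qed (rule x)
  qed
  \<comment> \<open>An edge from \<open>B - K\<close> to \<open>K\<close> lies inside
    \<open>B\<close>, hence is not stubborn and would enlarge the component; and \<open>e\<close>
    leaves \<open>B\<close> at \<open>x\<close>, which is in \<open>K\<close>. So \<open>e'\<close>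
    alone would have to separate \<open>B - K\<close> from the rest.\<close>
  have "B \<subseteq> K"
  proof
    fix w assume w: "w \<in> B"
    show "w \<in> K"
    proof (rule ccontr)
      assume "w \<notin> K"
      have "x \<in> K" by (simp add: K_def)
      with \<open>w \<notin> K\<close> have "\<exists>p q. {p, q} \<in> E \<and> p \<in> B - K \<and> q \<notin> B - K \<and> {p, q} \<noteq> e'"
        using stubborn_not_only_boundary[OF e', of w "B - K" x] w BV xV by auto
      then obtain p q where pq: "{p, q} \<in> E" "p \<in> B - K" "q \<notin> B - K" "{p, q} \<noteq> e'" by blast
      show False
      proof (cases "q \<in> B")
        case True
        then have q: "q \<in> K" using pq by blast
        have "{q, p} \<in> E - S" using inside[of p q] pq True by (simp add: insert_commute)
        then have "(q, p) \<in> adj (E - S)" by (simp add: adj_iff)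
        with q have "p \<in> K" unfolding K_def by (auto intro: rtrancl.rtrancl_into_rtrancl)
        then show False using pq by blast
      next
        case False
        then have "{p, q} = {x, x'}" using cross[of p q] pq x by blast
        then have "p = x" using pq x by (auto simp: doubleton_eq_iff)
        then show False using pq \<open>x \<in> K\<close> by blast
      qed
    qed
  qed
  with KB have KB: "K = B" by blast
  define L where "L = V - B"
  define EL where "EL = induced_edges E L"
  have EL: "{u, v} \<in> EL \<longleftrightarrow> {u, v} \<in> E \<and> u \<in> L \<and> v \<in> L" for u v
    by (auto simp: EL_def induced_edges_def)
  \<comment> \<open>Over \<open>L\<close> the colouring \<open>\<Phi> e\<close> is proper, so the
    double cover splits into two sheets there. \<open>R\<close> is the orientation of the sheet of
    states (w, \<Phi> e w); the other sheet carries the reversed orientation.\<close>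
  define R where "R = {(u, v). {u, v} \<in> EL \<and> c {u, v} = \<Phi> e u}"
  have \<Phi>L: "\<Phi> e u \<noteq> \<Phi> e v" if "{u, v} \<in> EL" for u v
    using that \<Phi>[OF e, of u v] x unfolding EL by (auto simp: L_def doubleton_eq_iff)
  \<comment> \<open>The normalisation at e and e' makes the states (w, \<not> \<Phi> e w) over B a sink.\<close>
  have stay: "(fst q \<in> L \<and> (p, q) \<in> (arcs EL c)\<^sup>*) \<or> (fst q \<in> B \<and> snd q \<noteq> \<Phi> e (fst q))"
    if "(p, q) \<in> (arcs E c)\<^sup>*" and p: "fst p \<in> L" for p q
    using that(1)
  proof (induction rule: rtrancl_induct)
    case base
    then show ?case using p by simp
  next
    case (step q z)
    obtain w r where q: "q = (w, r)" by (cases q)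
    obtain w' where z: "z = (w', \<not> r)" and E: "{w, w'} \<in> E" "c {w, w'} = r"
      using step(2) by (auto simp: q arcs_def)
    have w': "w \<in> L \<longleftrightarrow> w \<notin> B" "w' \<in> L \<longleftrightarrow> w' \<notin> B" using edge_in[OF E(1)] by (auto simp: L_def)
    have bd: "c {w, w'} = \<Phi> e b" if "{a, b} = {w, w'}" "a \<in> L" "b \<in> B" for a b
    proof -
      have "{w, w'} = e \<or> {w, w'} = e'"
        using cross[of b a] that E by (auto simp: L_def insert_commute)
      moreover have "\<Phi> e b = \<Phi> e' b" using that by (simp add: B_def A_def)
      ultimately show ?thesis using \<Phi>c[OF e, of b] \<Phi>c[OF e', of b] that by auto
    qed
    show ?case
    proof (cases "w \<in> B"; cases "w' \<in> B")
      assume b: "w \<in> B" "w' \<in> B"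
      then have "{w, w'} \<noteq> e" using x by (auto simp: doubleton_eq_iff)
      then have "\<Phi> e w \<noteq> \<Phi> e w'" using \<Phi>[OF e E(1)] by blast
      then show ?thesis using step.IH b by (auto simp: q z L_def)
    next
      assume b: "w \<in> B" "w' \<notin> B"
      then show ?thesis using bd[of w' w] step.IH E w' by (auto simp: q z insert_commute L_def)
    next
      assume b: "w \<notin> B" "w' \<in> B"
      then show ?thesis using bd[of w w'] E w' by (auto simp: q z)
    next
      assume b: "w \<notin> B" "w' \<notin> B"
      then have "(q, z) \<in> arcs EL c" using E w' by (simp add: q z arcs_iff EL)
      then show ?thesis using step.IH b w' by (auto simp: q z intro: rtrancl.rtrancl_into_rtrancl)
    qed
  qed
  have orient: "(snd p = \<Phi> e (fst p) \<longrightarrow> (fst p, fst q) \<in> R\<^sup>* \<and> snd q = \<Phi> e (fst q)) \<and>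
      (snd p \<noteq> \<Phi> e (fst p) \<longrightarrow> (fst q, fst p) \<in> R\<^sup>* \<and> snd q \<noteq> \<Phi> e (fst q))"
    if "(p, q) \<in> (arcs EL c)\<^sup>*" for p q
    using that
  proof (induction rule: rtrancl_induct)
    case (step q z)
    obtain w r where q: "q = (w, r)" by (cases q)
    obtain w' where z: "z = (w', \<not> r)" and E: "{w, w'} \<in> EL" "c {w, w'} = r"
      using step(2) by (auto simp: q arcs_def)
    have "r = \<Phi> e w \<Longrightarrow> (w, w') \<in> R" "r \<noteq> \<Phi> e w \<Longrightarrow> (w', w) \<in> R"
      using E \<Phi>L[OF E(1)] by (auto simp: R_def insert_commute)
    then show ?case
      using step.IH \<Phi>L[OF E(1)]
      by (auto simp: q z intro: rtrancl.rtrancl_into_rtrancl converse_rtrancl_into_rtrancl)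
  qed simp
  have "two_edge_connectable L EL"
  proof (rule two_edge_connectable_if_unilateral[where R = R])
    show "finite L" using finite_V by (simp add: L_def)
    show "finite EL" using finite_E by (simp add: EL_def induced_edges_def)
    show "L \<noteq> {}" using x by (auto simp: L_def)
    show "\<forall>e\<in>EL. e \<subseteq> L" by (simp add: EL_def induced_edges_def)
    show "R \<subseteq> adj EL" by (auto simp: R_def adj_iff)
    show "(v, u) \<notin> R" if "(u, v) \<in> R" for u v
      using that \<Phi>L[of u v] by (auto simp: R_def insert_commute)
    show "(u, v) \<in> R\<^sup>* \<or> (v, u) \<in> R\<^sup>*" if uv: "u \<in> L" "v \<in> L" for u v
    proof -
      obtain s t where "((u, s), (v, t)) \<in> (arcs E c)\<^sup>*" using pc[of u v] uv by (auto simp: L_def)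
      from stay[OF this] uv have "((u, s), (v, t)) \<in> (arcs EL c)\<^sup>*" by (auto simp: L_def)
      from orient[OF this] show ?thesis by auto
    qed
  qed
  then show ?thesis using KS unfolding KB L_def EL_def by blast
qed

end

section \<open>From a component to a colouring\<close>

text \<open>A bridge whose ends have equal colours is repaired by switching the colours on one of
  its sides.\<close>

lemma two_colouring_add_bridges:
  fixes \<phi> :: "'a \<Rightarrow> bool"
  assumes "finite N" "\<forall>n\<in>N. card n = 2" "\<And>a b. {a, b} \<in> F \<Longrightarrow> \<phi> a \<noteq> \<phi> b"
    and "\<And>u v. {u, v} \<in> N \<Longrightarrow> (u, v) \<notin> (adj (F \<union> N - {{u, v}}))\<^sup>*"
  shows "\<exists>\<psi> :: 'a \<Rightarrow> bool. \<forall>a b. {a, b} \<in> F \<union> N \<longrightarrow> \<psi> a \<noteq> \<psi> b"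
  using assms
proof (induction N rule: finite_induct)
  case empty
  then show ?case by auto
next
  case (insert n N)
  have "(u, v) \<notin> (adj (F \<union> N - {{u, v}}))\<^sup>*" if "{u, v} \<in> N" for u v
    using insert.prems(3)[of u v] that
      adj_rtrancl_mono[of u v "F \<union> N - {{u, v}}" "F \<union> insert n N - {{u, v}}"] by blast
  then obtain \<psi> :: "'a \<Rightarrow> bool" where \<psi>: "\<forall>a b. {a, b} \<in> F \<union> N \<longrightarrow> \<psi> a \<noteq> \<psi> b"
    using insert.IH insert.prems by auto
  obtain u v where n: "n = {u, v}" using insert.prems(1) by (auto simp: card_2_iff)
  show ?case
  proof (cases "n \<in> F \<or> \<psi> u \<noteq> \<psi> v")
    case True
    then show ?thesis using \<psi> n by (intro exI[of _ \<psi>]) (auto simp: doubleton_eq_iff)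
  next
    case False
    then have "F \<union> insert n N - {{u, v}} = F \<union> N" using insert.hyps n by auto
    then have no: "(u, v) \<notin> (adj (F \<union> N))\<^sup>*" using insert.prems(3)[of u v] n by simp
    define C where "C = {w. (u, w) \<in> (adj (F \<union> N))\<^sup>*}"
    have C: "b \<in> C" if "{a, b} \<in> F \<union> N" "a \<in> C" for a b
    proof -
      have "(a, b) \<in> adj (F \<union> N)" using that by (simp add: adj_iff)
      then show ?thesis using that(2) unfolding C_def by (auto intro: rtrancl.rtrancl_into_rtrancl)
    qed
    have uv: "u \<in> C" "v \<notin> C" using no by (auto simp: C_def)
    have "(\<psi> a \<noteq> (a \<in> C)) \<noteq> (\<psi> b \<noteq> (b \<in> C))" if ab: "{a, b} \<in> F \<union> insert n N" for a b
    proof (cases "{a, b} = n")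
      case True
      then show ?thesis using uv False n by (auto simp: doubleton_eq_iff)
    next
      case ne: False
      then have "{a, b} \<in> F \<union> N" using ab by blast
      then have "\<psi> a \<noteq> \<psi> b" "a \<in> C \<longleftrightarrow> b \<in> C"
        using \<psi> C[of a b] C[of b a] by (auto simp: insert_commute)
      then show ?thesis by blast
    qed
    then show ?thesis by (intro exI[of _ "\<lambda>a. \<psi> a \<noteq> (a \<in> C)"]) blast
  qed
qed

text \<open>The set of vertices that reach the root is grown edge by edge. An edge of
  \<open>F\<close> can be passed from any state by cyclicity, while an edge of \<open>W\<close>
  receives its colour at the moment it is used to attach a new vertex.\<close>

lemma colour_towards_root:
  assumes "finite V" "\<forall>e\<in>F \<union> W. e \<subseteq> V" "x \<in> V" "F \<inter> W = {}" and cyc: "cyclic (arcs F c)"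
  obtains c' where "\<And>e. e \<notin> W \<Longrightarrow> c' e = c e"
    "\<And>u. (x, u) \<in> (adj (F \<union> W))\<^sup>* \<Longrightarrow> \<exists>s. ((u, s), (x, t0)) \<in> (arcs (F \<union> W) c')\<^sup>*"
proof -
  define P where "P Y c' \<longleftrightarrow> (\<forall>e. e \<notin> W \<longrightarrow> c' e = c e) \<and>
    (\<forall>u\<in>Y. \<exists>s. ((u, s), (x, t0)) \<in> (arcs (F \<union> {w \<in> W. w \<subseteq> Y}) c')\<^sup>*)" for Y c'
  define Q where "Q Y \<longleftrightarrow> Y \<subseteq> V \<and> x \<in> Y \<and> (\<exists>c'. P Y c')" for Y
  have "P {x} c" unfolding P_def by auto
  then have "Q {x}" unfolding Q_def using assms(3) by blast
  moreover have "\<forall>Y. Q Y \<longrightarrow> card Y < Suc (card V)"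
    using assms(1) by (auto simp: Q_def less_Suc_eq_le card_mono)
  ultimately obtain Y where Y: "Q Y" and max: "\<And>Z. Q Z \<Longrightarrow> card Z \<le> card Y"
    using ex_has_greatest_nat[of Q "{x}" card] by blast
  obtain c' where YV: "Y \<subseteq> V" "x \<in> Y" and c': "P Y c'" using Y by (auto simp: Q_def)
  have off: "\<And>e. e \<notin> W \<Longrightarrow> c' e = c e"
    and reach: "\<And>u. u \<in> Y \<Longrightarrow> \<exists>s. ((u, s), (x, t0)) \<in> (arcs (F \<union> {w \<in> W. w \<subseteq> Y}) c')\<^sup>*"
    using c' unfolding P_def by blast+
  have closed: "b \<in> Y" if ab: "{a, b} \<in> F \<union> W" "a \<in> Y" for a b
  proof (rule ccontr)
    assume b: "b \<notin> Y"
    obtain t where t: "((a, t), (x, t0)) \<in> (arcs (F \<union> {w \<in> W. w \<subseteq> Y}) c')\<^sup>*"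
      using reach ab by blast
    define Z where "Z = insert b Y"
    \<comment> \<open>A step along an edge arrives in the negation of its colour, so colour \<not> t
      leads to (a, t), from where the root is reached. The edge does not lie inside
      \<open>Y\<close>, so the paths found earlier survive its recolouring.\<close>
    define d where "d = (if {a, b} \<in> W then c'({a, b} := \<not> t) else c')"
    let ?D = "arcs (F \<union> {w \<in> W. w \<subseteq> Z}) d"
    have "arcs (F \<union> {w \<in> W. w \<subseteq> Y}) c' \<subseteq> ?D"
      by (rule arcs_mono) (use b assms(4) in \<open>auto simp: Z_def d_def\<close>)
    then have mono: "(arcs (F \<union> {w \<in> W. w \<subseteq> Y}) c')\<^sup>* \<subseteq> ?D\<^sup>*" by (rule rtrancl_mono)
    have "arcs F c \<subseteq> ?D"
      by (rule arcs_mono) (use off assms(4) in \<open>auto simp: d_def\<close>)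
    then have monoF: "(arcs F c)\<^sup>* \<subseteq> ?D\<^sup>*" by (rule rtrancl_mono)
    have "((b, \<not> t), (a, t)) \<in> ?D\<^sup>*"
    proof (cases "{a, b} \<in> W")
      case True
      then have "((b, \<not> t), (a, t)) \<in> ?D"
        using ab by (simp add: arcs_iff d_def Z_def insert_commute)
      then show ?thesis by blast
    next
      case False
      then have "((b, \<not> t), (a, t)) \<in> all_arcs F" using ab by (simp add: all_arcs_iff insert_commute)
      then show ?thesis using all_arcs_subset_cyclic[OF cyc] monoF by blast
    qed
    moreover have "((a, t), (x, t0)) \<in> ?D\<^sup>*" using t mono by blast
    ultimately have new: "((b, \<not> t), (x, t0)) \<in> ?D\<^sup>*" by (rule rtrancl_trans)
    have "P Z d"
      unfolding P_def
    proof (intro conjI ballI allI impI)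
      fix u assume "u \<in> Z"
      then consider "u = b" | "u \<in> Y" by (auto simp: Z_def)
      then show "\<exists>s. ((u, s), (x, t0)) \<in> ?D\<^sup>*"
      proof cases
        case 1
        then show ?thesis using new by blast
      next
        case 2
        then show ?thesis using reach mono by blast
      qed
    qed (use off in \<open>auto simp: d_def\<close>)
    moreover have "b \<in> V" using ab assms(2) by blast
    ultimately have "Q Z" using YV unfolding Q_def by (auto simp: Z_def)
    then have "card Z \<le> card Y" by (rule max)
    moreover have "finite Y" using YV assms(1) finite_subset by blast
    ultimately show False using b by (simp add: Z_def)
  qed
  have "u \<in> Y" if "(x, u) \<in> (adj (F \<union> W))\<^sup>*" for u
    using that
  proof (induction rule: rtrancl_induct)
    case (step a b)
    then show ?case using closed[of a b] by (simp add: adj_iff)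
  qed (rule YV)
  moreover have "(arcs (F \<union> {w \<in> W. w \<subseteq> Y}) c')\<^sup>* \<subseteq> (arcs (F \<union> W) c')\<^sup>*"
    by (intro rtrancl_mono arcs_mono) auto
  ultimately show thesis using that[OF off] reach by blast
qed

text \<open>In a smallest subset of \<open>E1\<close> joining \<open>x\<close> and \<open>y\<close>,
  every edge is closed into a cycle by the connection through \<open>E2\<close>; it is then no
  bridge of the union and must belong to \<open>F\<close>.\<close>

lemma joined_avoiding_bridges:
  assumes fin: "finite E1" and two: "\<forall>e\<in>E1. card e = 2" and disj: "E1 \<inter> E2 = {}"
    and xy1: "(x, y) \<in> (adj E1)\<^sup>*" and xy2: "(x, y) \<in> (adj E2)\<^sup>*"
    and br: "\<And>a b. {a, b} \<in> E1 - F \<Longrightarrow> (a, b) \<notin> (adj (E1 \<union> E2 - {{a, b}}))\<^sup>*"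
  shows "(x, y) \<in> (adj F)\<^sup>*"
proof -
  define Q where "Q G \<longleftrightarrow> G \<subseteq> E1 \<and> (x, y) \<in> (adj G)\<^sup>*" for G
  have "Q E1" using xy1 by (simp add: Q_def)
  then obtain G where G: "Q G" and min: "\<And>H. Q H \<Longrightarrow> card G \<le> card H"
    using ex_has_least_nat[of Q E1 card] by blast
  have "G \<subseteq> F"
  proof (rule ccontr)
    assume "\<not> G \<subseteq> F"
    then obtain g where g: "g \<in> G" "g \<notin> F" by blast
    then have "card g = 2" using G two by (auto simp: Q_def)
    then obtain a b where gab: "g = {a, b}" by (auto simp: card_2_iff)
    have "finite G" using G fin finite_subset by (auto simp: Q_def)
    then have "card (G - {g}) < card G" using g by (intro card_Diff1_less)
    then have "\<not> Q (G - {g})" using min[of "G - {g}"] by linarith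
    then have no: "(x, y) \<notin> (adj (G - {g}))\<^sup>*" using G by (auto simp: Q_def)
    have "adj G = insert (a, b) (insert (b, a) (adj (G - {g})))"
      using g gab by (auto simp: adj_def doubleton_eq_iff insert_commute)
    then have "(x, y) \<in> (insert (a, b) (insert (b, a) (adj (G - {g}))))\<^sup>*"
      using G by (simp add: Q_def)
    then have *: "(x, a) \<in> (adj (G - {g}))\<^sup>* \<and> (b, y) \<in> (adj (G - {g}))\<^sup>* \<or>
        (x, b) \<in> (adj (G - {g}))\<^sup>* \<and> (a, y) \<in> (adj (G - {g}))\<^sup>*"
      using no unfolding rtrancl_insert_iff by (auto dest: rtrancl_trans)
    let ?H = "E1 \<union> E2 - {g}"
    have sub: "G - {g} \<subseteq> ?H" "E2 \<subseteq> ?H" using G g disj by (auto simp: Q_def)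
    have "(x, y) \<in> (adj ?H)\<^sup>*" "(y, x) \<in> (adj ?H)\<^sup>*"
      using adj_rtrancl_mono[OF xy2 sub(2)] adj_rtrancl_sym[of x y ?H] by auto
    moreover have "(x, a) \<in> (adj ?H)\<^sup>* \<and> (b, y) \<in> (adj ?H)\<^sup>* \<or> (x, b) \<in> (adj ?H)\<^sup>* \<and> (a, y) \<in> (adj ?H)\<^sup>*"
      using * adj_rtrancl_mono[OF _ sub(1)] by blast
    ultimately have "(a, b) \<in> (adj ?H)\<^sup>*"
      using adj_rtrancl_sym[of x a ?H] adj_rtrancl_sym[of b y ?H] by (meson rtrancl_trans)
    then show False using br[of a b] g gab G by (auto simp: Q_def)
  qed
  then show ?thesis using G adj_rtrancl_mono[of x y G F] by (simp add: Q_def)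
qed

text \<open>\<open>k\<close> selects one of the two sheets over the bipartite graph
  \<open>F\<close>. Cyclicity makes each sheet as connected by directed paths as \<open>F\<close> is
  by undirected ones.\<close>

lemma cyclic_two_colouring_reach:
  fixes \<phi> :: "'a \<Rightarrow> bool"
  assumes "cyclic (arcs F c)" and "\<And>a b. {a, b} \<in> F \<Longrightarrow> \<phi> a \<noteq> \<phi> b" and "(u, v) \<in> (adj F)\<^sup>*"
  shows "((u, \<phi> u = k), (v, \<phi> v = k)) \<in> (arcs F c)\<^sup>*"
  using assms(3)
proof (induction rule: rtrancl_induct)
  case (step y z)
  then have "{y, z} \<in> F" by (simp add: adj_iff)
  then have "((y, \<phi> y = k), (z, \<phi> z = k)) \<in> all_arcs F"
    using assms(2)[of y z] by (auto simp: all_arcs_iff)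
  then have "((y, \<phi> y = k), (z, \<phi> z = k)) \<in> (arcs F c)\<^sup>*"
    using all_arcs_subset_cyclic[OF assms(1)] by blast
  with step.IH show ?case by (rule rtrancl_trans)
qed simp

section \<open>Collecting the bridges on one path\<close>

lemma simple_path:
  assumes "(a, b) \<in> R\<^sup>*"
  obtains q :: "nat \<Rightarrow> 'a" and m where "q 0 = a" "q m = b" "inj_on q {..m}"
    "\<And>i. i < m \<Longrightarrow> (q i, q (Suc i)) \<in> R"
proof -
  define m where "m = (LEAST n. (a, b) \<in> R ^^ n)"
  have ex: "\<exists>n. (a, b) \<in> R ^^ n" using assms rtrancl_imp_relpow by blast
  then have m: "(a, b) \<in> R ^^ m" unfolding m_def by (rule LeastI_ex)
  have least: "m \<le> n" if "(a, b) \<in> R ^^ n" for n unfolding m_def using that by (rule Least_le)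
  obtain q where q: "q 0 = a" "q m = b" "\<forall>i<m. (q i, q (Suc i)) \<in> R"
    using m by (auto simp: relpow_fun_conv)
  have seg: "(q i, q j) \<in> R ^^ (j - i)" if "i \<le> j" "j \<le> m" for i j
    unfolding relpow_fun_conv
    by (rule exI[of _ "\<lambda>k. q (i + k)"]) (use that q in auto)
  have "q i \<noteq> q j" if "i < j" "j \<le> m" for i j
  proof
    assume eq: "q i = q j"
    have "(a, q i) \<in> R ^^ i" using seg[of 0 i] that q by simp
    moreover have "(q i, b) \<in> R ^^ (m - j)" using seg[of j m] that q eq by simp
    ultimately have "(a, b) \<in> R ^^ (i + (m - j))" by (auto simp: relpow_add)
    then show False using least[of "i + (m - j)"] that by linarith
  qed
  then have "inj_on q {..m}" by (metis atMost_iff inj_onI linorder_neqE_nat)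
  with q that show thesis by blast
qed

text \<open>An added edge repairs only those bridges that separate its two ends, so every path
  between these ends passes through all of \<open>N\<close>. The path may be reversed, which puts
  the positions belonging to \<open>u0\<close> and \<open>v0\<close> in order.\<close>

lemma bridges_on_path:
  assumes fin: "finite EL" and sub: "\<forall>e\<in>EL. e \<subseteq> L" and two: "\<forall>e\<in>EL. card e = 2"
    and N: "N \<subseteq> EL" and br: "\<And>u v. {u, v} \<in> N \<Longrightarrow> (u, v) \<notin> (adj (EL - {{u, v}}))\<^sup>*"
    and tec: "two_edge_connectable L EL" and uv: "u0 \<in> L" "v0 \<in> L"
  obtains q :: "nat \<Rightarrow> 'a" and m i j where "inj_on q {..m}" "\<And>i. i < m \<Longrightarrow> {q i, q (Suc i)} \<in> EL"
    "\<And>u. u \<in> L \<Longrightarrow> \<exists>i\<le>m. (u, q i) \<in> (adj (EL - N))\<^sup>*"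
    "i \<le> j" "j \<le> m" "(u0, q i) \<in> (adj (EL - N))\<^sup>*" "(v0, q j) \<in> (adj (EL - N))\<^sup>*"
    "\<And>u v. u \<in> L \<Longrightarrow> v \<in> L \<Longrightarrow> (u, v) \<in> (adj EL)\<^sup>*"
proof -
  have subL: "\<forall>e\<in>EL - {g}. e \<subseteq> L" for g using sub by blast
  \<comment> \<open>The vertices are the ends of the added edge; if the graph is 2-edge-connected
    already, \<open>N\<close> is empty and any two vertices serve.\<close>
  have "\<exists>a\<in>L. \<exists>b\<in>L. (\<forall>u\<in>L. \<forall>v\<in>L. (u, v) \<in> (adj EL)\<^sup>*) \<and> (\<forall>n\<in>N. (a, b) \<notin> (adj (EL - {n}))\<^sup>*)"
  proof (cases "two_edge_connected L (mset_set EL)")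
    case True
    then have "connected_graph L EL" using fin by (simp add: two_edge_connected_def)
    then have conn: "\<forall>u\<in>L. \<forall>v\<in>L. (u, v) \<in> (adj EL)\<^sup>*"
      using joined_iff_adj[OF sub] by (simp add: connected_graph_def)
    have "n \<notin> N" for n
    proof
      assume n: "n \<in> N"
      then have "card n = 2" using N two by blast
      then obtain u v where nuv: "n = {u, v}" by (auto simp: card_2_iff)
      have "n \<subseteq> L" using n N sub by blast
      then have "v \<in> L" using nuv by simp
      then have "\<not> joined L (EL - {n}) u v"
        using br[of u v] n nuv joined_iff_adj[OF subL[of n]] by simp
      moreover have nE: "n \<in> EL" using n N by blast
      ultimately have "bridge L (mset_set EL) n"
        unfolding bridge_def set_mset_mset_set_remove[OF fin nE] using nuv fin by auto
      then show False using True by (simp add: two_edge_connected_def)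
    qed
    then show ?thesis using conn uv by blast
  next
    case False
    then obtain f where f: "f \<subseteq> L" "card f = 2" "two_edge_connected L (add_mset f (mset_set EL))"
      using tec by (auto simp: two_edge_connectable_def)
    then obtain a b where ab: "f = {a, b}" by (auto simp: card_2_iff)
    have abL: "a \<in> L" "b \<in> L" using ab f by auto
    let ?M = "add_mset f (mset_set EL)"
    have nobr: "joined L (set_mset (?M - {#g#})) x y" if "g \<in># ?M" "g = {x, y}" for g x y
      using f that by (auto simp: two_edge_connected_def bridge_def)
    have "joined L EL a b" using nobr[of f a b] ab fin by simp
    then have abE: "(a, b) \<in> (adj EL)\<^sup>*" using joined_iff_adj[OF sub abL(2)] by simp
    have extra: "(adj (insert f G))\<^sup>* \<subseteq> (adj G)\<^sup>*" if "(a, b) \<in> (adj G)\<^sup>*" for G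
    proof (rule rtrancl_subset_rtrancl, clarify)
      fix x y assume "(x, y) \<in> adj (insert f G)"
      then consider "{x, y} = {a, b}" | "(x, y) \<in> adj G" using ab by (auto simp: adj_iff)
      then show "(x, y) \<in> (adj G)\<^sup>*"
      proof cases
        case 1
        then show ?thesis using that adj_rtrancl_sym[OF that] unfolding doubleton_eq_iff by blast
      qed blast
    qed
    have subf: "\<forall>e\<in>insert f EL. e \<subseteq> L" using sub f by blast
    have "connected_graph L (insert f EL)" using f fin by (simp add: two_edge_connected_def)
    then have "\<forall>u\<in>L. \<forall>v\<in>L. (u, v) \<in> (adj (insert f EL))\<^sup>*"
      using joined_iff_adj[OF subf] by (simp add: connected_graph_def)
    then have conn: "\<forall>u\<in>L. \<forall>v\<in>L. (u, v) \<in> (adj EL)\<^sup>*" using extra[OF abE] by blast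
    \<comment> \<open>If \<open>a\<close> and \<open>b\<close> stayed joined without
      \<open>n\<close>, the added edge would connect nothing new and \<open>n\<close> would remain a
      bridge. When the added edge is parallel to \<open>n\<close>, its ends are those of
      \<open>n\<close> and the contradiction is immediate.\<close>
    have "(a, b) \<notin> (adj (EL - {n}))\<^sup>*" if n: "n \<in> N" for n
    proof
      assume path: "(a, b) \<in> (adj (EL - {n}))\<^sup>*"
      have "card n = 2" using n N two by blast
      then obtain u v where nuv: "n = {u, v}" by (auto simp: card_2_iff)
      have "n \<subseteq> L" using n N sub by blast
      then have vL: "v \<in> L" using nuv by simp
      have no: "(u, v) \<notin> (adj (EL - {n}))\<^sup>*" using br[of u v] n nuv by simp
      show False
      proof (cases "n = f")
        case True
        then have "{u, v} = {a, b}" using nuv ab by simp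
        then show False using path adj_rtrancl_sym[OF path] no unfolding doubleton_eq_iff by blast
      next
        case nf: False
        have nE: "n \<in> EL" using n N by blast
        have "set_mset (?M - {#n#}) = insert f (EL - {n})"
          using nf nE fin by (simp add: set_mset_mset_set_remove)
        then have "joined L (insert f (EL - {n})) u v" using nobr[of n u v] nuv nE fin by simp
        moreover have "\<forall>e\<in>insert f (EL - {n}). e \<subseteq> L" using subf by blast
        ultimately have "(u, v) \<in> (adj (insert f (EL - {n})))\<^sup>*"
          using joined_iff_adj[OF _ vL] by blast
        then show False using extra[OF path] no by blast
      qed
    qed
    then show ?thesis using conn abL by blast
  qed
  then obtain a b where ab: "a \<in> L" "b \<in> L" and conn: "\<And>u v. u \<in> L \<Longrightarrow> v \<in> L \<Longrightarrow> (u, v) \<in> (adj EL)\<^sup>*"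
    and sep: "\<And>n. n \<in> N \<Longrightarrow> (a, b) \<notin> (adj (EL - {n}))\<^sup>*" by blast
  obtain q m where q: "q 0 = a" "q m = b" "inj_on q {..m}" "\<And>i. i < m \<Longrightarrow> (q i, q (Suc i)) \<in> adj EL"
    using simple_path[OF conn[OF ab]] by blast
  have onN: "\<exists>i<m. n = {q i, q (Suc i)}" if "n \<in> N" for n
  proof (rule ccontr)
    assume none: "\<not> ?thesis"
    have "(q 0, q i) \<in> (adj (EL - {n}))\<^sup>*" if "i \<le> m" for i
      using that
    proof (induction i)
      case (Suc i)
      then have "i < m" by simp
      then have "{q i, q (Suc i)} \<in> EL" "n \<noteq> {q i, q (Suc i)}"
        using q(4)[of i] none unfolding adj_iff by blast+
      then have "(q i, q (Suc i)) \<in> adj (EL - {n})" unfolding adj_iff by blast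
      with Suc \<open>i < m\<close> show ?case by (meson less_imp_le rtrancl.rtrancl_into_rtrancl)
    qed simp
    then show False using sep[OF that] q(1,2) by blast
  qed
  \<comment> \<open>On a walk towards \<open>a\<close>, the first edge of \<open>N\<close> that is
    met already has its ends on the path.\<close>
  have near: "\<exists>i\<le>m. (u, q i) \<in> (adj (EL - N))\<^sup>*" if "u \<in> L" for u
  proof -
    have "(u, a) \<in> (adj EL)\<^sup>*" using conn that ab by blast
    then show ?thesis
    proof (induction rule: converse_rtrancl_induct)
      case base
      then show ?case using q(1) by (intro exI[of _ 0]) auto
    next
      case (step u w)
      show ?case
      proof (cases "{u, w} \<in> N")
        case True
        then obtain i where "i < m" "{u, w} = {q i, q (Suc i)}" using onN by blast
        then have "u = q i \<and> i \<le> m \<or> u = q (Suc i) \<and> Suc i \<le> m" by (auto simp: doubleton_eq_iff)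
        then show ?thesis by blast
      next
        case False
        then have "(u, w) \<in> adj (EL - N)" using step by (simp add: adj_iff)
        then show ?thesis using step.IH by (meson converse_rtrancl_into_rtrancl)
      qed
    qed
  qed
  obtain i where i: "i \<le> m" "(u0, q i) \<in> (adj (EL - N))\<^sup>*" using near uv by blast
  obtain j where j: "j \<le> m" "(v0, q j) \<in> (adj (EL - N))\<^sup>*" using near uv by blast
  show thesis
  proof (cases "i \<le> j")
    case True
    show thesis by (rule that[of q m i j]) (use q near True i j conn in \<open>auto simp: adj_iff\<close>)
  next
    case False
    define p where "p k = q (m - k)" for k
    show thesis
    proof (rule that[of p m "m - i" "m - j"])
      show "inj_on p {..m}"
      proof (rule inj_onI)
        fix k l assume "k \<in> {..m}" "l \<in> {..m}" "p k = p l"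
        then have "m - k = m - l" using inj_onD[OF q(3), of "m - k" "m - l"] by (simp add: p_def)
        then show "k = l" using \<open>k \<in> {..m}\<close> \<open>l \<in> {..m}\<close> by simp
      qed
      show "{p k, p (Suc k)} \<in> EL" if "k < m" for k
        using q(4)[of "m - Suc k"] that by (simp add: p_def adj_iff Suc_diff_Suc insert_commute)
      show "\<exists>k\<le>m. (u, p k) \<in> (adj (EL - N))\<^sup>*" if u: "u \<in> L" for u
      proof -
        obtain k where "k \<le> m" "(u, q k) \<in> (adj (EL - N))\<^sup>*" using near[OF u] by blast
        then show ?thesis by (intro exI[of _ "m - k"]) (simp add: p_def)
      qed
    qed (use False i j conn in \<open>auto simp: p_def\<close>)
  qed
qed

text \<open>Go from \<open>u\<close> to the root, around the tour that negates the state there, and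
  out along the skew image of the way from \<open>v\<close>.\<close>

lemma arcs_connected_via_root:
  assumes "((x, k), (x, \<not> k)) \<in> (arcs E c)\<^sup>*"
    and "\<exists>s. ((u, s), (x, k)) \<in> (arcs E c)\<^sup>*" "\<exists>s. ((v, s), (x, k)) \<in> (arcs E c)\<^sup>*"
  shows "\<exists>s t. ((u, s), (v, t)) \<in> (arcs E c)\<^sup>*"
proof -
  obtain s t where u: "((u, s), (x, k)) \<in> (arcs E c)\<^sup>*" and v: "((v, t), (x, k)) \<in> (arcs E c)\<^sup>*"
    using assms by blast
  from skew_rtrancl[OF skew_arcs v] have "((x, \<not> k), (v, \<not> t)) \<in> (arcs E c)\<^sup>*" by simp
  then have "((u, s), (v, \<not> t)) \<in> (arcs E c)\<^sup>*" using u assms(1) by (meson rtrancl_trans)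
  then show ?thesis by blast
qed

section \<open>Colourings built around an odd tour\<close>

context nonbipartite_graph
begin

text \<open>With \<phi> normalised to the colour of \<open>e\<close>, crossing \<open>e\<close>
  leads into the states whose Boolean differs from \<phi>. No arc leaves them, so the arc has no way
  back.\<close>

lemma stubborn_not_coloured:
  assumes "e \<in> S" "F \<subseteq> E" "cyclic (arcs F c)"
  shows "e \<notin> F"
proof
  assume eF: "e \<in> F"
  obtain \<phi> :: "'a \<Rightarrow> bool" where \<phi>: "\<forall>a b. {a, b} \<in> E \<longrightarrow> (\<phi> a = \<phi> b) = ({a, b} = e)"
    and \<phi>e: "\<forall>x\<in>e. \<phi> x = c e"
    using normalised_stubborn_colouring[OF assms(1), of "c e"] by blast
  obtain x y where e: "e = {x, y}" using stubborn_in[OF assms(1)] by (auto elim: edgeE)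
  have "((x, c e), (y, \<not> c e)) \<in> arcs F c" using eF e by (simp add: arcs_iff)
  then have "((y, \<not> c e), (x, c e)) \<in> (arcs F c)\<^sup>*" using assms(3) by (simp add: cyclic_def)
  moreover have "snd q \<noteq> \<phi> (fst q)" if "((y, \<not> c e), q) \<in> (arcs F c)\<^sup>*" for q
    using that
  proof (induction rule: rtrancl_induct)
    case base
    then show ?case using \<phi>e e by simp
  next
    case (step q z)
    then obtain a b where q: "q = (a, c {a, b})" "z = (b, \<not> c {a, b})" "{a, b} \<in> F"
      by (auto simp: arcs_def)
    then have "{a, b} \<noteq> e" using step.IH \<phi>e by auto
    then have "\<phi> a \<noteq> \<phi> b" using \<phi> q(3) assms(2) by blast
    then show ?case using step.IH q by auto
  qed
  ultimately have "c e \<noteq> \<phi> x" by fastforce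
  then show False using \<phi>e e by simp
qed

text \<open>Either the cyclic part already contains an odd tour, or it is bipartite and a stubborn
  edge supplies the change of state, the way back lying in \<open>F\<close>. All other uncoloured
  edges are directed towards the root of that tour.\<close>

lemma colouring_if_spanning_component:
  assumes F: "F \<subseteq> E" "cyclic (arcs F c)"
    and bs: "\<And>u v. {u, v} \<in> E - F \<Longrightarrow> {u, v} \<notin> S \<Longrightarrow> (u, v) \<notin> (adj (E - {{u, v}}))\<^sup>*"
    and K: "\<And>u v. u \<in> V \<Longrightarrow> v \<in> V \<Longrightarrow> (u, v) \<in> (adj (E - S))\<^sup>*"
  shows "\<exists>c. \<forall>u\<in>V. \<forall>v\<in>V. \<exists>s t. ((u, s), (v, t)) \<in> (arcs E c)\<^sup>*"
proof (cases "\<exists>r. ((r, True), (r, False)) \<in> (arcs F c)\<^sup>*")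
  case True
  then obtain r where r: "((r, True), (r, False)) \<in> (arcs F c)\<^sup>*" by blast
  then have rV: "r \<in> V"
  proof (cases rule: converse_rtranclE)
    case (step y)
    then show ?thesis using edge_in F by (auto simp: arcs_def)
  qed simp
  have FW: "F \<union> (E - F) = E" using F by blast
  obtain c' where c': "\<And>e. e \<notin> E - F \<Longrightarrow> c' e = c e"
    "\<And>u. (r, u) \<in> (adj E)\<^sup>* \<Longrightarrow> \<exists>s. ((u, s), (r, True)) \<in> (arcs E c')\<^sup>*"
    using colour_towards_root[OF finite_V _ rV _ F(2), of "E - F" True] edge_subset
    unfolding FW by blast
  have "arcs F c \<subseteq> arcs E c'" by (rule arcs_mono) (use F c'(1) in auto)
  then have "((r, True), (r, \<not> True)) \<in> (arcs E c')\<^sup>*" using r rtrancl_mono by auto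
  from arcs_connected_via_root[OF this] c'(2) all_joined rV show ?thesis by meson
next
  case False
  \<comment> \<open>Otherwise every uncoloured edge is a bridge, and adding bridges to the bipartite
    graph \<open>F\<close> would keep it bipartite.\<close>
  have "\<exists>e. e \<in> S \<and> e \<notin> F"
  proof (rule ccontr)
    assume none: "\<nexists>e. e \<in> S \<and> e \<notin> F"
    have "(all_arcs F)\<^sup>* \<subseteq> (arcs F c)\<^sup>*"
      by (rule rtrancl_subset_rtrancl[OF all_arcs_subset_cyclic[OF F(2)]])
    then have "\<And>r. ((r, True), (r, False)) \<notin> (all_arcs F)\<^sup>*" using False by blast
    then obtain \<phi> :: "'a \<Rightarrow> bool" where \<phi>: "\<And>a b. {a, b} \<in> F \<Longrightarrow> \<phi> a \<noteq> \<phi> b"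
      using two_colouring_if_no_odd_closed_walk[of F] by blast
    have FE: "F \<union> (E - F) = E" using F by blast
    have "\<exists>\<psi> :: 'a \<Rightarrow> bool. \<forall>a b. {a, b} \<in> F \<union> (E - F) \<longrightarrow> \<psi> a \<noteq> \<psi> b"
    proof (rule two_colouring_add_bridges[OF _ _ \<phi>])
      show "finite (E - F)" using finite_E by simp
      show "\<forall>n\<in>E - F. card n = 2" using edge_card by blast
      show "(u, v) \<notin> (adj (F \<union> (E - F) - {{u, v}}))\<^sup>*" if "{u, v} \<in> E - F" for u v
        using bs[OF that] none that unfolding FE by blast
    qed
    then show False using no_two_colouring unfolding FE by blast
  qed
  then obtain e where e: "e \<in> S" "e \<notin> F" by blast
  obtain \<phi> :: "'a \<Rightarrow> bool" where \<phi>: "\<And>a b. {a, b} \<in> E \<Longrightarrow> (\<phi> a = \<phi> b) \<longleftrightarrow> {a, b} = e"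
    using stubborn_colouring[OF e(1)] by blast
  have eE: "e \<in> E" using e stubborn_in by blast
  then obtain x y where xy: "e = {x, y}" "x \<in> V" "y \<in> V" by (auto elim: edgeE)
  have \<phi>xy: "\<phi> x = \<phi> y" using \<phi>[of x y] eE xy by simp
  have \<phi>F: "\<phi> a \<noteq> \<phi> b" if "{a, b} \<in> F" for a b
    using \<phi>[of a b] that F e by blast
  have xyF: "(x, y) \<in> (adj F)\<^sup>*"
  proof (rule joined_avoiding_bridges[of "E - S" "{e}"])
    show "(a, b) \<notin> (adj (E - S \<union> {e} - {{a, b}}))\<^sup>*" if "{a, b} \<in> E - S - F" for a b
      using bs[of a b] that eE adj_rtrancl_mono[of a b "E - S \<union> {e} - {{a, b}}" "E - {{a, b}}"]
      by blast
    show "(x, y) \<in> (adj {e})\<^sup>*" using xy by (auto simp: adj_iff)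
  qed (use finite_E edge_card e K xy in auto)
  have FW: "F \<union> (E - F - {e}) = E - {e}" using F e by blast
  obtain c' where c': "\<And>g. g \<notin> E - F - {e} \<Longrightarrow> c' g = c g"
    "\<And>u. (x, u) \<in> (adj (E - {e}))\<^sup>* \<Longrightarrow> \<exists>s. ((u, s), (x, \<phi> x)) \<in> (arcs (E - {e}) c')\<^sup>*"
    using colour_towards_root[OF finite_V _ xy(2) _ F(2), of "E - F - {e}" "\<phi> x"] edge_subset
    unfolding FW by blast
  define d where "d = c'(e := \<phi> x)"
  have "arcs (E - {e}) c' \<subseteq> arcs E d" by (rule arcs_mono) (auto simp: d_def)
  then have mono: "(arcs (E - {e}) c')\<^sup>* \<subseteq> (arcs E d)\<^sup>*" by (rule rtrancl_mono)
  have "arcs F c \<subseteq> arcs E d" by (rule arcs_mono) (use F e c'(1) in \<open>auto simp: d_def\<close>)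
  then have monoF: "(arcs F c)\<^sup>* \<subseteq> (arcs E d)\<^sup>*" by (rule rtrancl_mono)
  have root: "\<exists>s. ((u, s), (x, \<phi> x)) \<in> (arcs E d)\<^sup>*" if "u \<in> V" for u
  proof -
    have "(x, u) \<in> (adj (E - {e}))\<^sup>*"
      by (rule adj_rtrancl_mono[OF K[OF xy(2) that]]) (use e in blast)
    then show ?thesis using c'(2) mono by blast
  qed
  have xy': "((x, \<phi> x), (y, \<not> \<phi> y)) \<in> arcs E d"
    using eE xy \<phi>xy by (simp add: arcs_iff d_def)
  have "((y, \<not> \<phi> y), (x, \<not> \<phi> x)) \<in> (arcs F c)\<^sup>*"
    using cyclic_two_colouring_reach[where \<phi> = \<phi> and k = False, OF F(2) \<phi>F adj_rtrancl_sym[OF xyF]]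
    by simp
  from converse_rtrancl_into_rtrancl[OF xy' subsetD[OF monoF this]]
  have "((x, \<phi> x), (x, \<not> \<phi> x)) \<in> (arcs E d)\<^sup>*" .
  from arcs_connected_via_root[OF this] root show ?thesis by meson
qed

lemma colouring_if_connectable_complement:
  assumes F: "F \<subseteq> E" "cyclic (arcs F c)"
    and bs: "\<And>u v. {u, v} \<in> E - F \<Longrightarrow> {u, v} \<notin> S \<Longrightarrow> (u, v) \<notin> (adj (E - {{u, v}}))\<^sup>*"
    and K: "K \<in> stubborn_free_components V E" and ne: "V - K \<noteq> {}"
    and tec: "two_edge_connectable (V - K) (induced_edges E (V - K))"
  shows "\<exists>c. \<forall>u\<in>V. \<forall>v\<in>V. \<exists>s t. ((u, s), (v, t)) \<in> (arcs E c)\<^sup>*"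
proof -
  obtain x x' y y' where eS: "{x, x'} \<in> S" "{y, y'} \<in> S" and ee': "{x, x'} \<noteq> {y, y'}"
    and xK: "x \<in> K" "y \<in> K" and xL: "x' \<in> V - K" "y' \<in> V - K"
    by (rule component_boundary[OF K ne])
  obtain r where r: "r \<in> V" "K = {v. (r, v) \<in> (adj (E - S))\<^sup>*}"
    using K component_eq by (auto simp: stubborn_free_components_def components_def)
  have KV: "K \<subseteq> V" using K by (auto simp: stubborn_free_components_def components_def)
  define e where "e = {x, x'}"
  define e' where "e' = {y, y'}"
  define L where "L = V - K"
  define EL where "EL = induced_edges E L"
  define EK where "EK = {g \<in> E - S. g \<subseteq> K}"
  have EL: "{u, v} \<in> EL \<longleftrightarrow> {u, v} \<in> E \<and> u \<in> L \<and> v \<in> L" for u v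
    by (auto simp: EL_def induced_edges_def)
  have ELE: "EL \<subseteq> E" "\<forall>g\<in>EL. g \<subseteq> L" by (auto simp: EL_def induced_edges_def)
  have eE: "e \<in> E" "e' \<in> E" using eS stubborn_in by (auto simp: e_def e'_def)
  have eF: "e \<notin> F" "e' \<notin> F" using stubborn_not_coloured[OF _ F] eS by (auto simp: e_def e'_def)
  have eEL: "e \<notin> EL" "e' \<notin> EL" using xK by (auto simp: e_def e'_def EL L_def)
  have KL: "\<not> (g \<subseteq> K \<and> g \<subseteq> L)" if "g \<in> E" for g
    using edge_card that by (fastforce simp: L_def card_2_iff)
  obtain \<phi> :: "'a \<Rightarrow> bool" where \<phi>: "\<And>a b. {a, b} \<in> E \<Longrightarrow> (\<phi> a = \<phi> b) \<longleftrightarrow> {a, b} = e"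
    using stubborn_colouring[OF eS(1)] unfolding e_def by blast
  have \<phi>F: "\<phi> a \<noteq> \<phi> b" if "{a, b} \<in> F" for a b
    using \<phi>[of a b] that F eF by blast
  have \<phi>L: "\<phi> a \<noteq> \<phi> b" if "{a, b} \<in> EL" for a b
    using \<phi>[of a b] that ELE eEL by blast
  have \<phi>x: "\<phi> x' = \<phi> x" using \<phi>[of x x'] eE by (simp add: e_def)
  have \<phi>y: "\<phi> y' = (\<not> \<phi> y)" using \<phi>[of y y'] eE ee' by (auto simp: e_def e'_def)
  have EK: "(u, v) \<in> (adj EK)\<^sup>*" if "u \<in> K" "v \<in> K" for u v
  proof -
    have "(r, w) \<in> (adj EK)\<^sup>*" if "w \<in> K" for w
    proof -
      have "(r, w) \<in> (adj (E - S))\<^sup>*" using that r by simp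
      then show ?thesis
      proof (induction rule: rtrancl_induct)
        case (step a b)
        then have "(r, b) \<in> (adj (E - S))\<^sup>*" by (meson rtrancl.rtrancl_into_rtrancl)
        then have "{a, b} \<in> EK" using step r(2) by (auto simp: EK_def adj_iff)
        then have "(a, b) \<in> adj EK" by (simp add: adj_iff)
        with step.IH show ?case by (rule rtrancl.rtrancl_into_rtrancl)
      qed simp
    qed
    then show ?thesis using that adj_rtrancl_sym[of r u EK] by (meson rtrancl_trans)
  qed
  define N where "N = EL - F"
  \<comment> \<open>A stubborn edge is no bridge of the whole graph, but inside \<open>L\<close> it
    is one: \<phi> and \<psi> are both proper on the remaining edges of \<open>L\<close>, so whether
    they agree is constant along walks there, yet it differs at \<open>u\<close> and
    \<open>v\<close>.\<close>
  have Nbr: "(u, v) \<notin> (adj (EL - {{u, v}}))\<^sup>*" if n: "{u, v} \<in> N" for u v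
  proof (cases "{u, v} \<in> S")
    case False
    have "(u, v) \<notin> (adj (E - {{u, v}}))\<^sup>*" using bs False n ELE by (auto simp: N_def)
    then show ?thesis using adj_rtrancl_mono[of u v "EL - {{u, v}}" "E - {{u, v}}"] ELE by blast
  next
    case True
    obtain \<psi> :: "'a \<Rightarrow> bool" where \<psi>: "\<And>a b. {a, b} \<in> E \<Longrightarrow> (\<psi> a = \<psi> b) \<longleftrightarrow> {a, b} = {u, v}"
      using stubborn_colouring[OF True] by blast
    have uvEL: "{u, v} \<in> EL" using n by (simp add: N_def)
    have "(\<phi> u = \<psi> u) = (\<phi> w = \<psi> w)" if "(u, w) \<in> (adj (EL - {{u, v}}))\<^sup>*" for w
      using that
    proof (induction rule: rtrancl_induct)
      case (step a b)
      then have "{a, b} \<in> EL" "{a, b} \<noteq> {u, v}" by (auto simp: adj_iff)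
      then have "\<phi> a \<noteq> \<phi> b" "\<psi> a \<noteq> \<psi> b" using \<phi>L[of a b] \<psi>[of a b] ELE by blast+
      then show ?case using step.IH by blast
    qed simp
    moreover have "\<phi> u \<noteq> \<phi> v" "\<psi> u = \<psi> v" using \<phi>L[OF uvEL] \<psi>[of u v] uvEL ELE by blast+
    ultimately show ?thesis by blast
  qed
  have finEL: "finite EL" using ELE finite_E finite_subset by blast
  have twoEL: "\<forall>g\<in>EL. card g = 2" using ELE edge_card by blast
  have xL': "x' \<in> L" "y' \<in> L" using xL by (auto simp: L_def)
  have tecL: "two_edge_connectable L EL" using tec by (simp add: L_def EL_def)
  have N: "N \<subseteq> EL" by (auto simp: N_def)
  obtain q m i j where inj: "inj_on q {..m}" and qE: "\<And>i. i < m \<Longrightarrow> {q i, q (Suc i)} \<in> EL"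
    and near: "\<And>u. u \<in> L \<Longrightarrow> \<exists>i\<le>m. (u, q i) \<in> (adj (EL - N))\<^sup>*"
    and ij: "i \<le> j" "j \<le> m" and xi: "(x', q i) \<in> (adj (EL - N))\<^sup>*"
    and yj: "(y', q j) \<in> (adj (EL - N))\<^sup>*"
    and connL: "\<And>u v. u \<in> L \<Longrightarrow> v \<in> L \<Longrightarrow> (u, v) \<in> (adj EL)\<^sup>*"
    by (rule bridges_on_path[OF finEL ELE(2) twoEL N Nbr tecL xL']) blast+
  have toF: "(u, v) \<in> (adj (EL - N))\<^sup>* \<Longrightarrow> (u, v) \<in> (adj F)\<^sup>*" for u v
    by (erule adj_rtrancl_mono) (auto simp: N_def)
  \<comment> \<open>\<open>x\<close> and \<open>y\<close> are joined inside \<open>K\<close>, and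
    also outside through \<open>e\<close>, \<open>L\<close> and \<open>e'\<close>; these disjoint
    connections allow the bridges of \<open>K\<close> to be avoided.\<close>
  have xyF: "(x, y) \<in> (adj F)\<^sup>*"
  proof (rule joined_avoiding_bridges[of EK "EL \<union> {e, e'}"])
    show "finite EK" using finite_E by (simp add: EK_def)
    show "\<forall>g\<in>EK. card g = 2" using edge_card by (simp add: EK_def)
    have "e \<notin> EK" "e' \<notin> EK" using xL by (auto simp: EK_def e_def e'_def)
    moreover have "EK \<inter> EL = {}" using KL ELE by (auto simp: EK_def)
    ultimately show "EK \<inter> (EL \<union> {e, e'}) = {}" by blast
    show "(x, y) \<in> (adj EK)\<^sup>*" using EK xK by blast
    let ?H = "EL \<union> {e, e'}"
    have "(x, x') \<in> adj ?H" "(y', y) \<in> adj ?H"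
      by (auto simp: adj_iff e_def e'_def insert_commute)
    moreover have "(x', y') \<in> (adj ?H)\<^sup>*" by (rule adj_rtrancl_mono[OF connL[OF xL']]) blast
    ultimately show "(x, y) \<in> (adj ?H)\<^sup>*"
      by (meson converse_rtrancl_into_rtrancl rtrancl.rtrancl_into_rtrancl)
    show "(a, b) \<notin> (adj (EK \<union> ?H - {{a, b}}))\<^sup>*" if "{a, b} \<in> EK - F" for a b
    proof -
      have "(a, b) \<notin> (adj (E - {{a, b}}))\<^sup>*" using bs[of a b] that by (auto simp: EK_def)
      moreover have "EK \<union> ?H - {{a, b}} \<subseteq> E - {{a, b}}" using ELE eE by (auto simp: EK_def)
      ultimately show ?thesis using adj_rtrancl_mono[of a b] by blast
    qed
  qed
  define W where "W = EK - F"
  have xV: "x \<in> V" using xK KV by blast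
  have WV: "\<forall>g\<in>F \<union> W. g \<subseteq> V" using edge_subset F(1) unfolding W_def EK_def by blast
  have FW: "F \<inter> W = {}" by (auto simp: W_def)
  obtain cK where cK: "\<And>g. g \<notin> W \<Longrightarrow> cK g = c g"
    "\<And>u. (x, u) \<in> (adj (F \<union> W))\<^sup>* \<Longrightarrow> \<exists>s. ((u, s), (x, \<phi> x)) \<in> (arcs (F \<union> W) cK)\<^sup>*"
    using colour_towards_root[OF finite_V WV xV FW F(2), of "\<phi> x"] by blast
  \<comment> \<open>Injectivity of \<open>q\<close> makes the index unique for edges of the path;
    the value at other edges is arbitrary, and the walks below do not depend on it.\<close>
  define pos where "pos g = (THE i. i < m \<and> g = {q i, q (Suc i)})" for g
  have pos: "pos {q i, q (Suc i)} = i" if "i < m" for i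
    unfolding pos_def
  proof (rule the_equality)
    fix l assume l: "l < m \<and> {q i, q (Suc i)} = {q l, q (Suc l)}"
    then consider "q i = q l" | "q i = q (Suc l)" "q (Suc i) = q l" by (auto simp: doubleton_eq_iff)
    then show "l = i"
    proof cases
      case 1
      then show ?thesis using inj_onD[OF inj, of i l] l that by simp
    next
      case 2
      then have "i = Suc l" "Suc i = l"
        using inj_onD[OF inj, of i "Suc l"] inj_onD[OF inj, of "Suc i" l] l that by simp_all
      then show ?thesis by simp
    qed
  qed (use that in simp)
  \<comment> \<open>Path edges outside \<open>F\<close> run forward on the sheet of states (w,
    \<not> \<phi> w). The edges \<open>e\<close> and \<open>e'\<close> get the value of \<phi> at
    their ends in \<open>K\<close>, so both can be left from the sheet (w, \<phi> w) there.\<close>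
  define d where "d g = (if g \<in> F then c g else if g \<subseteq> K then cK g
    else if g \<subseteq> L then \<not> \<phi> (q (pos g)) else if g = e then \<phi> x else \<phi> y)" for g
  let ?D = "(arcs E d)\<^sup>*"
  have "arcs F c \<subseteq> arcs E d" by (rule arcs_mono) (use F in \<open>auto simp: d_def\<close>)
  then have monoF: "(arcs F c)\<^sup>* \<subseteq> ?D" by (rule rtrancl_mono)
  have "arcs (F \<union> W) cK \<subseteq> arcs E d"
    by (rule arcs_mono) (use F cK(1) in \<open>auto simp: d_def W_def EK_def\<close>)
  then have monoK: "(arcs (F \<union> W) cK)\<^sup>* \<subseteq> ?D" by (rule rtrancl_mono)
  have trans: "\<And>a b g. (a, b) \<in> ?D \<Longrightarrow> (b, g) \<in> ?D \<Longrightarrow> (a, g) \<in> ?D" by (rule rtrancl_trans)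
  have rev: "((b, \<not> t), (a, \<not> s)) \<in> ?D" if "((a, s), (b, t)) \<in> ?D" for a b s t
    using skew_rtrancl[OF skew_arcs that] by simp
  have same: "((u, \<phi> u), (v, \<phi> v)) \<in> ?D" "((u, \<not> \<phi> u), (v, \<not> \<phi> v)) \<in> ?D"
    if "(u, v) \<in> (adj F)\<^sup>*" for u v
    using cyclic_two_colouring_reach[where \<phi> = \<phi> and k = True, OF F(2) \<phi>F that]
      cyclic_two_colouring_reach[where \<phi> = \<phi> and k = False, OF F(2) \<phi>F that] monoF by auto
  have qstep: "((q i, \<not> \<phi> (q i)), (q (Suc i), \<not> \<phi> (q (Suc i)))) \<in> ?D" if i: "i < m" for i
  proof (cases "{q i, q (Suc i)} \<in> F")
    case True
    then show ?thesis by (intro same) (auto simp: adj_iff)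
  next
    case False
    have EL': "{q i, q (Suc i)} \<in> EL" using qE i by blast
    then have qiE: "{q i, q (Suc i)} \<in> E" and "{q i, q (Suc i)} \<subseteq> L" unfolding EL by simp_all
    moreover have "\<not> {q i, q (Suc i)} \<subseteq> K" using calculation by (auto simp: L_def)
    ultimately have "d {q i, q (Suc i)} = (\<not> \<phi> (q i))" using False pos[OF i] by (auto simp: d_def)
    then have "((q i, \<not> \<phi> (q i)), (q (Suc i), \<not> \<phi> (q (Suc i)))) \<in> arcs E d"
      using \<phi>L[OF EL'] qiE by (auto simp: arcs_iff)
    then show ?thesis by blast
  qed
  have chain: "((q k, \<not> \<phi> (q k)), (q l, \<not> \<phi> (q l))) \<in> ?D" if "k \<le> l" "l \<le> m" for k l
    using that
  proof (induction rule: dec_induct)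
    case (step l)
    then show ?case using trans[OF _ qstep[of l]] by simp
  qed simp
  have dx: "d e = \<phi> x" using eF xK xL' by (auto simp: d_def e_def L_def)
  have dy: "d e' = \<phi> y" using eF xK xL' ee' by (auto simp: d_def e_def e'_def L_def)
  have "((x, \<phi> x), (x', \<not> \<phi> x')) \<in> arcs E d"
    using dx eE \<phi>x by (simp add: arcs_iff e_def)
  then have xx': "((x, \<phi> x), (x', \<not> \<phi> x')) \<in> ?D" by blast
  have "((y, \<phi> y), (y', \<phi> y')) \<in> arcs E d"
    using dy eE \<phi>y by (simp add: arcs_iff e'_def)
  then have yy': "((y, \<phi> y), (y', \<phi> y')) \<in> ?D" by blast
  have xq: "((x, \<phi> x), (q k, \<not> \<phi> (q k))) \<in> ?D" if "i \<le> k" "k \<le> m" for k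
    using trans[OF xx' trans[OF same(2)[OF toF[OF xi]] chain[OF that]]] .
  \<comment> \<open>Only \<open>e\<close> changes the sheet, since \<phi> is proper at
    \<open>e'\<close>. The tour therefore comes home through the reversed lift of \<open>e'\<close>
    and closes inside \<open>F\<close> with the state negated.\<close>
  have qj: "((q j, \<not> \<phi> (q j)), (x, \<not> \<phi> x)) \<in> ?D"
    using trans[OF same(2)[OF toF[OF adj_rtrancl_sym[OF yj]]]
        trans[OF rev[OF yy'] same(2)[OF adj_rtrancl_sym[OF xyF]]]] .
  have loop: "((x, \<phi> x), (x, \<not> \<phi> x)) \<in> ?D" using trans[OF xq[OF ij] qj] .
  have KR: "\<exists>s. ((u, s), (x, \<phi> x)) \<in> ?D" if "u \<in> K" for u
  proof -
    have "(x, u) \<in> (adj (F \<union> W))\<^sup>*"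
      by (rule adj_rtrancl_mono[OF EK[OF xK(1) that]]) (auto simp: W_def)
    then show ?thesis using cK(2) monoK by blast
  qed
  have xL2: "\<exists>t. ((x, \<phi> x), (v, t)) \<in> ?D" if v: "v \<in> L" for v
  proof -
    obtain k where k: "k \<le> m" "(v, q k) \<in> (adj (EL - N))\<^sup>*" using near[OF v] by blast
    have qv: "(q k, v) \<in> (adj F)\<^sup>*" using toF[OF adj_rtrancl_sym[OF k(2)]] .
    show ?thesis
    proof (cases "i \<le> k")
      case True
      then show ?thesis using trans[OF xq[OF True k(1)] same(2)[OF qv]] by blast
    next
      \<comment> \<open>Vertices attached before \<open>q i\<close> cannot be reached by entering
        through \<open>e\<close>; they are reached through \<open>e'\<close>, following the path
        backwards on the other sheet.\<close>
      case False
      then have "k \<le> j" using ij by simp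
      from rev[OF chain[OF this ij(2)]] have "((q j, \<phi> (q j)), (q k, \<phi> (q k))) \<in> ?D" by simp
      from trans[OF this same(1)[OF qv]] have "((q j, \<phi> (q j)), (v, \<phi> v)) \<in> ?D" .
      from trans[OF same(1)[OF xyF] trans[OF yy' trans[OF same(1)[OF toF[OF yj]] this]]]
      show ?thesis by blast
    qed
  qed
  have KLc: "\<exists>s t. ((u, s), (v, t)) \<in> ?D" if "u \<in> K" "v \<in> L" for u v
    using KR[OF that(1)] xL2[OF that(2)] trans by blast
  have LL: "\<exists>s t. ((u, s), (v, t)) \<in> ?D" if u: "u \<in> L" and v: "v \<in> L" for u v
  proof -
    obtain k where k: "k \<le> m" "(u, q k) \<in> (adj F)\<^sup>*" using near[OF u] toF by blast
    obtain l where l: "l \<le> m" "(v, q l) \<in> (adj F)\<^sup>*" using near[OF v] toF by blast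
    show ?thesis
    proof (cases "k \<le> l")
      case True
      from trans[OF same(2)[OF k(2)] trans[OF chain[OF True l(1)] same(2)[OF adj_rtrancl_sym[OF l(2)]]]]
      show ?thesis by blast
    next
      case False
      then have "l \<le> k" by simp
      from trans[OF same(2)[OF l(2)] trans[OF chain[OF this k(1)] same(2)[OF adj_rtrancl_sym[OF k(2)]]]]
      have "((v, \<not> \<phi> v), (u, \<not> \<phi> u)) \<in> ?D" .
      from rev[OF this] show ?thesis by blast
    qed
  qed
  have "\<exists>s t. ((u, s), (v, t)) \<in> ?D" if uv: "u \<in> V" "v \<in> V" for u v
  proof (cases "u \<in> K"; cases "v \<in> K")
    assume "u \<in> K" "v \<in> K"
    then show ?thesis using arcs_connected_via_root[OF loop] KR by blast
  next
    assume "u \<in> K" "v \<notin> K"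
    then show ?thesis using KLc uv by (simp add: L_def)
  next
    assume "u \<notin> K" "v \<in> K"
    then obtain s t where "((v, s), (u, t)) \<in> ?D" using KLc[of v u] uv by (auto simp: L_def)
    from rev[OF this] show ?thesis by blast
  next
    assume "u \<notin> K" "v \<notin> K"
    then show ?thesis using LL uv by (simp add: L_def)
  qed
  then show ?thesis by blast
qed

theorem colouring_if_stubborn_free_component:
  assumes K: "K \<in> stubborn_free_components V E"
    and "V - K = {} \<or> two_edge_connectable (V - K) (induced_edges E (V - K))"
  shows "\<exists>c. \<forall>u\<in>V. \<forall>v\<in>V. \<exists>s t. ((u, s), (v, t)) \<in> (arcs E c)\<^sup>*"
proof -
  obtain F c where F: "F \<subseteq> E" "cyclic (arcs F c)"
    and no: "\<And>u v s. {u, v} \<in> E - F \<Longrightarrow> ((u, s), (v, \<not> s)) \<notin> (all_arcs (E - {{u, v}}))\<^sup>*"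
    by (rule skew_orientation[OF finite_E edge_card]) blast
  have bs: "(u, v) \<notin> (adj (E - {{u, v}}))\<^sup>*" if "{u, v} \<in> E - F" "{u, v} \<notin> S" for u v
    using bridge_or_stubborn[of u v] no that by blast
  show ?thesis
  proof (cases "V - K = {}")
    case True
    obtain r where r: "r \<in> V" "K = {v. (r, v) \<in> (adj (E - S))\<^sup>*}"
      using K component_eq by (auto simp: stubborn_free_components_def components_def)
    have "(u, v) \<in> (adj (E - S))\<^sup>*" if "u \<in> V" "v \<in> V" for u v
    proof -
      have "(r, u) \<in> (adj (E - S))\<^sup>*" "(r, v) \<in> (adj (E - S))\<^sup>*" using that True r by auto
      then show ?thesis using adj_rtrancl_sym[of r u] by (meson rtrancl_trans)
    qed
    then show ?thesis using colouring_if_spanning_component[OF F bs] by blast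
  next
    case False
    then show ?thesis using colouring_if_connectable_complement[OF F bs K False] assms(2) by blast
  qed
qed

end

section \<open>The equivalence, with colours 1 and 2 read as truth values\<close>

theorem theorem6:
  fixes V :: "'a set" and E :: "'a set set"
  assumes "finite V"
    and "simple_graph V E"
    and "connected_graph V E"
    and "\<not> bipartite V E"
  shows "(\<exists>c :: 'a set \<Rightarrow> nat. (\<forall>e\<in>E. c e \<in> {1, 2}) \<and> properly_connected V E c) \<longleftrightarrow>
    (\<exists>K \<in> stubborn_free_components V E.
      V - K = {} \<or> two_edge_connectable (V - K) (induced_edges E (V - K)))"
proof -
  interpret nonbipartite_graph V E by unfold_locales (fact assms)+
  show ?thesis
  proof
    assume "\<exists>c :: 'a set \<Rightarrow> nat. (\<forall>e\<in>E. c e \<in> {1, 2}) \<and> properly_connected V E c"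
    then obtain c :: "'a set \<Rightarrow> nat" where c: "\<forall>e\<in>E. c e \<in> {1, 2}" "properly_connected V E c"
      by blast
    have "\<exists>s t. ((u, s), (v, t)) \<in> (arcs E (\<lambda>e. c e = 1))\<^sup>*" if uv: "u \<in> V" "v \<in> V" for u v
    proof -
      obtain p where p: "walk V E p" "hd p = u" "last p = v" "properly_coloured c p"
        using c(2) uv unfolding properly_connected_def by blast
      then show ?thesis
        using proper_walk_imp_arcs[of p E c "c (hd (walk_edges p)) = 1"] c(1)
        unfolding walk_def by blast
    qed
    then show "\<exists>K \<in> stubborn_free_components V E.
      V - K = {} \<or> two_edge_connectable (V - K) (induced_edges E (V - K))"
      by (rule stubborn_free_component_if_colouring)
  next
    assume "\<exists>K \<in> stubborn_free_components V E.
      V - K = {} \<or> two_edge_connectable (V - K) (induced_edges E (V - K))"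
    then obtain c where c: "\<forall>u\<in>V. \<forall>v\<in>V. \<exists>s t. ((u, s), (v, t)) \<in> (arcs E c)\<^sup>*"
      using colouring_if_stubborn_free_component by blast
    have "properly_connected V E (\<lambda>e. if c e then 1 else 2)"
      unfolding properly_connected_def
    proof (intro ballI)
      fix u v assume uv: "u \<in> V" "v \<in> V"
      then obtain s t where "((u, s), (v, t)) \<in> (arcs E c)\<^sup>*" using c by blast
      from arcs_imp_proper_walk[OF this edge_subset uv(2)]
      show "\<exists>p. walk V E p \<and> hd p = u \<and> last p = v \<and> properly_coloured (\<lambda>e. if c e then 1 else 2) p"
        by blast
    qed
    then show "\<exists>c :: 'a set \<Rightarrow> nat. (\<forall>e\<in>E. c e \<in> {1, 2}) \<and> properly_connected V E c"
      by (intro exI[of _ "\<lambda>e. if c e then 1 else 2"]) simp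
  qed
qed

end
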